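(* There is a polynomial-time reduction from the Discrete Segment Covering (DISC-SC) problem to the $(s,z,t)$-Temporal Separator problem.
   Context: DISC-SC: given a finite set $\Gamma$ of segments (intervals) on the rational line and a finite set $\mathcal{I}$ of unit-length intervals on the rational line, find a minimum-size subset $A\subseteq\mathcal{I}$ covering all segments of $\Gamma$, where an interval $I$ covers a segment $C$ if at least one endpoint of $C$ lies in $I$, and $A$ covers $C$ if some $I\in A$ covers $C$. A temporal graph $G=(V,E,\tau)$ consists of a finite vertex set $V$ and a set of time-labelled undirected edges $E \subseteq V\times V\times[\tau]$ ($(u,v,t')\in E$ iff $(v,u,t')\in E$, no loops). An $(s,z)$-temporal path is a sequence of edges $(u_1,v_1,t_1),\dots,(u_k,v_k,t_k)$ forming a path from $s$ to $z$ with $t_1\le\dots\le t_k$; its travelling time is $t_k-t_1+1$, and it is an $(s,z,t)$-temporal path if this is at most $t$. An $(s,z,t)$-temporal separator is a set $S\subseteq V\setminus\{s,z\}$ meeting every $(s,z,t)$-temporal path; the $(s,z,t)$-Temporal Separator problem asks for one of minimum size. *)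

theory Defs
  imports
    Complex_Main
    "HOL-Computational_Algebra.Polynomial"
    "HOL-Library.Log_Nat"
begin

section \<open>Polynomial-time computation\<close>

text \<open>
  The machine model is a WHILE language over S-expressions with integer atoms, under the
  logarithmic cost criterion: every evaluation of a subexpression is charged the size in bits of
  the value it yields.  Each operation is computable by a Turing machine in time polynomial in the
  sizes of its operands, all of which are charged, and a Turing machine is simulated
  by keeping the two halves of its tape as lists; hence polynomial time in this model is
  polynomial time on Turing machines, for decision problems as well as for functions.
\<close>

datatype sexp = Atom int | Cell sexp sexp

fun size_sexp :: "sexp \<Rightarrow> nat" where
  "size_sexp (Atom i) = 1 + floorlog 2 (nat \<bar>i\<bar>)"
| "size_sexp (Cell x y) = 1 + size_sexp x + size_sexp y"

text \<open>All operations are total: a cell counts as 0 in arithmetic, and the components of an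
  atom are the atom 0.\<close>

fun atom_val :: "sexp \<Rightarrow> int" where
  "atom_val (Atom i) = i"
| "atom_val (Cell x y) = 0"

fun car :: "sexp \<Rightarrow> sexp" where
  "car (Cell x y) = x"
| "car (Atom i) = Atom 0"

fun cdr :: "sexp \<Rightarrow> sexp" where
  "cdr (Cell x y) = y"
| "cdr (Atom i) = Atom 0"

fun is_cell :: "sexp \<Rightarrow> bool" where
  "is_cell (Cell x y) = True"
| "is_cell (Atom i) = False"

datatype expr =
    Var nat
  | Lit int
  | Plus expr expr
  | Minus expr expr
  | Times expr expr
  | Leq expr expr
  | Cons_of expr expr
  | Car expr
  | Cdr expr
  | Is_cell expr

type_synonym store = "nat \<Rightarrow> sexp"

fun val_of :: "expr \<Rightarrow> store \<Rightarrow> sexp" where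
  "val_of (Var x) \<sigma> = \<sigma> x"
| "val_of (Lit i) \<sigma> = Atom i"
| "val_of (Plus a b) \<sigma> = Atom (atom_val (val_of a \<sigma>) + atom_val (val_of b \<sigma>))"
| "val_of (Minus a b) \<sigma> = Atom (atom_val (val_of a \<sigma>) - atom_val (val_of b \<sigma>))"
| "val_of (Times a b) \<sigma> = Atom (atom_val (val_of a \<sigma>) * atom_val (val_of b \<sigma>))"
| "val_of (Leq a b) \<sigma> = Atom (if atom_val (val_of a \<sigma>) \<le> atom_val (val_of b \<sigma>) then 1 else 0)"
| "val_of (Cons_of a b) \<sigma> = Cell (val_of a \<sigma>) (val_of b \<sigma>)"
| "val_of (Car a) \<sigma> = car (val_of a \<sigma>)"
| "val_of (Cdr a) \<sigma> = cdr (val_of a \<sigma>)"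
| "val_of (Is_cell a) \<sigma> = Atom (if is_cell (val_of a \<sigma>) then 1 else 0)"

fun expr_cost :: "expr \<Rightarrow> store \<Rightarrow> nat" where
  "expr_cost (Var x) \<sigma> = size_sexp (val_of (Var x) \<sigma>)"
| "expr_cost (Lit i) \<sigma> = size_sexp (val_of (Lit i) \<sigma>)"
| "expr_cost (Plus a b) \<sigma> = expr_cost a \<sigma> + expr_cost b \<sigma> + size_sexp (val_of (Plus a b) \<sigma>)"
| "expr_cost (Minus a b) \<sigma> = expr_cost a \<sigma> + expr_cost b \<sigma> + size_sexp (val_of (Minus a b) \<sigma>)"
| "expr_cost (Times a b) \<sigma> = expr_cost a \<sigma> + expr_cost b \<sigma> + size_sexp (val_of (Times a b) \<sigma>)"
| "expr_cost (Leq a b) \<sigma> = expr_cost a \<sigma> + expr_cost b \<sigma> + size_sexp (val_of (Leq a b) \<sigma>)"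
| "expr_cost (Cons_of a b) \<sigma> = expr_cost a \<sigma> + expr_cost b \<sigma> + size_sexp (val_of (Cons_of a b) \<sigma>)"
| "expr_cost (Car a) \<sigma> = expr_cost a \<sigma> + size_sexp (val_of (Car a) \<sigma>)"
| "expr_cost (Cdr a) \<sigma> = expr_cost a \<sigma> + size_sexp (val_of (Cdr a) \<sigma>)"
| "expr_cost (Is_cell a) \<sigma> = expr_cost a \<sigma> + size_sexp (val_of (Is_cell a) \<sigma>)"

datatype prog =
    Skip
  | Assign nat expr
  | Seq prog prog
  | If expr prog prog
  | While expr prog

text \<open>\<open>exec c \<sigma> n \<sigma>'\<close>: started in \<open>\<sigma>\<close>, the program \<open>c\<close> halts in \<open>\<sigma>'\<close> after time \<open>n\<close>.\<close>

inductive exec :: "prog \<Rightarrow> store \<Rightarrow> nat \<Rightarrow> store \<Rightarrow> bool" where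
  Skip: "exec Skip \<sigma> 1 \<sigma>"
| Assign: "exec (Assign x a) \<sigma> (1 + expr_cost a \<sigma>) (\<sigma>(x := val_of a \<sigma>))"
| Seq: "exec c \<sigma> m \<sigma>' \<Longrightarrow> exec d \<sigma>' n \<sigma>'' \<Longrightarrow> exec (Seq c d) \<sigma> (m + n) \<sigma>''"
| If_true: "val_of a \<sigma> \<noteq> Atom 0 \<Longrightarrow> exec c \<sigma> n \<sigma>' \<Longrightarrow>
    exec (If a c d) \<sigma> (1 + expr_cost a \<sigma> + n) \<sigma>'"
| If_false: "val_of a \<sigma> = Atom 0 \<Longrightarrow> exec d \<sigma> n \<sigma>' \<Longrightarrow>
    exec (If a c d) \<sigma> (1 + expr_cost a \<sigma> + n) \<sigma>'"
| While_false: "val_of a \<sigma> = Atom 0 \<Longrightarrow> exec (While a c) \<sigma> (1 + expr_cost a \<sigma>) \<sigma>"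
| While_true: "val_of a \<sigma> \<noteq> Atom 0 \<Longrightarrow> exec c \<sigma> m \<sigma>' \<Longrightarrow> exec (While a c) \<sigma>' n \<sigma>'' \<Longrightarrow>
    exec (While a c) \<sigma> (1 + expr_cost a \<sigma> + m + n) \<sigma>''"

inductive_cases exec_elims:
  "exec Skip \<sigma> n \<sigma>'"
  "exec (Assign x a) \<sigma> n \<sigma>'"
  "exec (Seq c d) \<sigma> n \<sigma>'"
  "exec (If a c d) \<sigma> n \<sigma>'"
  "exec (While a c) \<sigma> n \<sigma>'"

lemma exec_deterministic:
  "exec c \<sigma> m \<sigma>' \<Longrightarrow> exec c \<sigma> n \<sigma>'' \<Longrightarrow> n = m \<and> \<sigma>'' = \<sigma>'"
proof (induction arbitrary: n \<sigma>'' rule: exec.induct)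
  case (While_true a \<sigma> c m \<sigma>1 k \<sigma>2)
  show ?case
    by (rule exec_elims(5)[OF While_true.prems]) (use While_true.hyps in \<open>auto dest!: While_true.IH\<close>)
next
  case (While_false a \<sigma> c)
  show ?case
    by (rule exec_elims(5)[OF While_false.prems]) (use While_false.hyps in auto)
next
  case (If_true a \<sigma> c m \<sigma>1 d)
  show ?case
    by (rule exec_elims(4)[OF If_true.prems]) (use If_true.hyps in \<open>auto dest!: If_true.IH\<close>)
next
  case (If_false a \<sigma> d m \<sigma>1 c)
  show ?case
    by (rule exec_elims(4)[OF If_false.prems]) (use If_false.hyps in \<open>auto dest!: If_false.IH\<close>)
next
  case (Seq c \<sigma> m \<sigma>1 d k \<sigma>2)
  show ?case
    by (rule exec_elims(3)[OF Seq.prems]) (auto dest!: Seq.IH)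
qed (auto elim: exec_elims(1,2))

definition init_store :: "sexp \<Rightarrow> store" where
  "init_store v = (\<lambda>_. Atom 0)(0 := v)"

text \<open>Input and output are in variable 0.  The program and the polynomial are uniform in the
  input; outside of the promise \<open>D\<close> nothing is required.\<close>

definition poly_time_on :: "sexp set \<Rightarrow> (sexp \<Rightarrow> sexp) \<Rightarrow> bool" where
  "poly_time_on D f \<longleftrightarrow>
    (\<exists>c (p :: nat poly). \<forall>v\<in>D. \<exists>n \<sigma>.
      exec c (init_store v) n \<sigma> \<and> \<sigma> 0 = f v \<and> n \<le> poly p (size_sexp v))"


section \<open>Minimisation problems and reductions between them\<close>

text \<open>\<open>inst_code\<close> and \<open>sol_code\<close> are relations, since a finite set has one code
  for every order in which its elements can be listed.\<close>

record ('i, 's) min_problem =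
  insts :: "'i set"
  sols :: "'i \<Rightarrow> 's set"
  cost :: "'s \<Rightarrow> nat"
  inst_code :: "'i \<Rightarrow> sexp \<Rightarrow> bool"
  sol_code :: "'s \<Rightarrow> sexp \<Rightarrow> bool"

definition optimal :: "('i, 's) min_problem \<Rightarrow> 'i \<Rightarrow> 's \<Rightarrow> bool" where
  "optimal P x S \<longleftrightarrow> S \<in> sols P x \<and> (\<forall>S'\<in>sols P x. cost P S \<le> cost P S')"

definition inst_codes :: "('i, 's) min_problem \<Rightarrow> sexp set" where
  "inst_codes P = {v. \<exists>x\<in>insts P. inst_code P x v}"

text \<open>The inputs for the back map: a code \<open>v\<close> of a source instance, paired with a code of a solution
  of the target instance coded by \<open>f v\<close>.\<close>

definition back_codes ::
  "('i, 's) min_problem \<Rightarrow> ('j, 'r) min_problem \<Rightarrow> (sexp \<Rightarrow> sexp) \<Rightarrow> sexp set" where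
  "back_codes P Q f = {Cell v w | v w. v \<in> inst_codes P \<and>
     (\<exists>y\<in>insts Q. inst_code Q y (f v) \<and> (\<exists>S\<in>sols Q y. sol_code Q S w))}"

text \<open>A reduction consists of a map \<open>f\<close> on instances and a map \<open>g\<close> turning solutions of \<open>f v\<close>
  back into solutions of \<open>v\<close>, optimal ones into optimal ones.  Moreover \<open>f\<close>, with unchanged bound
  \<open>k\<close>, is a many-one reduction between the decision versions.\<close>

definition reduction ::
  "('i, 's) min_problem \<Rightarrow> ('j, 'r) min_problem \<Rightarrow> (sexp \<Rightarrow> sexp) \<Rightarrow> (sexp \<Rightarrow> sexp) \<Rightarrow> bool" where
  "reduction P Q f g \<longleftrightarrow>
    (\<forall>x\<in>insts P. \<forall>v. inst_code P x v \<longrightarrow>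
      (\<exists>y\<in>insts Q. inst_code Q y (f v) \<and>
        (\<forall>k. (\<exists>A\<in>sols P x. cost P A \<le> k) \<longleftrightarrow> (\<exists>S\<in>sols Q y. cost Q S \<le> k)) \<and>
        (\<forall>S\<in>sols Q y. \<forall>w. sol_code Q S w \<longrightarrow>
          (\<exists>A\<in>sols P x. sol_code P A (g (Cell v w)) \<and> (optimal Q y S \<longrightarrow> optimal P x A)))))"

definition poly_time_reducible ::
  "('i, 's) min_problem \<Rightarrow> ('j, 'r) min_problem \<Rightarrow> bool" where
  "poly_time_reducible P Q \<longleftrightarrow>
    (\<exists>f g. reduction P Q f g \<and> poly_time_on (inst_codes P) f \<and> poly_time_on (back_codes P Q f) g)"


section \<open>Encodings\<close>

definition code_nat :: "nat \<Rightarrow> sexp" where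
  "code_nat n = Atom (int n)"

definition code_rat :: "rat \<Rightarrow> sexp" where
  "code_rat r = Cell (Atom (fst (quotient_of r))) (Atom (snd (quotient_of r)))"

definition code_list :: "('a \<Rightarrow> sexp) \<Rightarrow> 'a list \<Rightarrow> sexp" where
  "code_list code xs = foldr (\<lambda>x v. Cell (code x) v) xs (Atom 0)"

definition codes_set :: "('a \<Rightarrow> sexp) \<Rightarrow> 'a set \<Rightarrow> sexp \<Rightarrow> bool" where
  "codes_set code A v \<longleftrightarrow> (\<exists>xs. distinct xs \<and> set xs = A \<and> v = code_list code xs)"


section \<open>Discrete Segment Covering\<close>

text \<open>The pair \<open>(a, b)\<close> stands for the closed interval \<open>{a..b}\<close>.\<close>

type_synonym interval = "rat \<times> rat"

definition covers :: "interval \<Rightarrow> interval \<Rightarrow> bool" where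
  "covers I C \<longleftrightarrow> fst C \<in> {fst I..snd I} \<or> snd C \<in> {fst I..snd I}"

definition disc_sc_instance :: "interval set \<Rightarrow> interval set \<Rightarrow> bool" where
  "disc_sc_instance \<Gamma> \<I> \<longleftrightarrow>
    finite \<Gamma> \<and> (\<forall>(a, b)\<in>\<Gamma>. a \<le> b) \<and> finite \<I> \<and> (\<forall>(a, b)\<in>\<I>. b - a = 1)"

definition disc_sc_cover :: "interval set \<Rightarrow> interval set \<Rightarrow> interval set \<Rightarrow> bool" where
  "disc_sc_cover \<Gamma> \<I> A \<longleftrightarrow> A \<subseteq> \<I> \<and> (\<forall>C\<in>\<Gamma>. \<exists>I\<in>A. covers I C)"

definition code_interval :: "interval \<Rightarrow> sexp" where
  "code_interval I = Cell (code_rat (fst I)) (code_rat (snd I))"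

definition disc_sc :: "(interval set \<times> interval set, interval set) min_problem" where
  "disc_sc =
    \<lparr> insts = {(\<Gamma>, \<I>). disc_sc_instance \<Gamma> \<I>},
      sols = (\<lambda>(\<Gamma>, \<I>). {A. disc_sc_cover \<Gamma> \<I> A}),
      cost = card,
      inst_code = (\<lambda>(\<Gamma>, \<I>) v. \<exists>v1 v2. v = Cell v1 v2 \<and>
        codes_set code_interval \<Gamma> v1 \<and> codes_set code_interval \<I> v2),
      sol_code = codes_set code_interval \<rparr>"


section \<open>Temporal separators\<close>

type_synonym 'v tedge = "'v \<times> 'v \<times> nat"

definition tail :: "'v tedge \<Rightarrow> 'v" where "tail e = fst e"
definition head :: "'v tedge \<Rightarrow> 'v" where "head e = fst (snd e)"
definition label :: "'v tedge \<Rightarrow> nat" where "label e = snd (snd e)"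

record 'v tgraph =
  verts :: "'v set"
  tedges :: "'v tedge set"
  lifetime :: nat

definition temporal_graph :: "'v tgraph \<Rightarrow> bool" where
  "temporal_graph G \<longleftrightarrow>
    finite (verts G) \<and>
    tedges G \<subseteq> verts G \<times> verts G \<times> {1..lifetime G} \<and>
    (\<forall>u v i. (u, v, i) \<in> tedges G \<longleftrightarrow> (v, u, i) \<in> tedges G) \<and>
    (\<forall>u i. (u, u, i) \<notin> tedges G)"

definition temporal_path :: "'v tgraph \<Rightarrow> 'v \<Rightarrow> 'v \<Rightarrow> 'v tedge list \<Rightarrow> bool" where
  "temporal_path G s z es \<longleftrightarrow>
    es \<noteq> [] \<and> set es \<subseteq> tedges G \<and>
    tail (hd es) = s \<and> head (last es) = z \<and>
    (\<forall>i. Suc i < length es \<longrightarrow> head (es ! i) = tail (es ! Suc i)) \<and>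
    distinct (s # map head es) \<and>
    sorted (map label es)"

text \<open>Natural subtraction is harmless here: the labels of a temporal path are sorted.\<close>

definition travelling_time :: "'v tedge list \<Rightarrow> nat" where
  "travelling_time es = label (last es) - label (hd es) + 1"

definition deadline_path :: "'v tgraph \<Rightarrow> 'v \<Rightarrow> 'v \<Rightarrow> nat \<Rightarrow> 'v tedge list \<Rightarrow> bool" where
  "deadline_path G s z t es \<longleftrightarrow> temporal_path G s z es \<and> travelling_time es \<le> t"

definition path_verts :: "'v tedge list \<Rightarrow> 'v set" where
  "path_verts es = tail ` set es \<union> head ` set es"

definition separator :: "'v tgraph \<Rightarrow> 'v \<Rightarrow> 'v \<Rightarrow> nat \<Rightarrow> 'v set \<Rightarrow> bool" where
  "separator G s z t S \<longleftrightarrow>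
    S \<subseteq> verts G - {s, z} \<and> (\<forall>es. deadline_path G s z t es \<longrightarrow> S \<inter> path_verts es \<noteq> {})"

definition code_tedge :: "nat tedge \<Rightarrow> sexp" where
  "code_tedge e = Cell (code_nat (tail e)) (Cell (code_nat (head e)) (code_nat (label e)))"

text \<open>So that instances can be written down, their vertices are natural numbers.\<close>

definition temporal_separator ::
  "(nat tgraph \<times> nat \<times> nat \<times> nat, nat set) min_problem" where
  "temporal_separator =
    \<lparr> insts = {(G, s, z, t). temporal_graph G \<and> s \<in> verts G \<and> z \<in> verts G \<and> s \<noteq> z},
      sols = (\<lambda>(G, s, z, t). {S. separator G s z t S}),
      cost = card,
      inst_code = (\<lambda>(G, s, z, t) v. \<exists>v1 v2.
        codes_set code_nat (verts G) v1 \<and> codes_set code_tedge (tedges G) v2 \<and>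
        v = Cell v1 (Cell v2 (Cell (code_nat (lifetime G))
              (Cell (code_nat s) (Cell (code_nat z) (code_nat t)))))),
      sol_code = codes_set code_nat \<rparr>"

end

theory Submission
  imports Defs
begin

text \<open>
  With deadline \<open>t = 1\<close> all edges of a relevant temporal path carry the same label.  The snapshots
  are therefore independent of each other, and the separator problem contains hitting set:
  the snapshot of the \<open>j\<close>-th segment is a simple path from \<open>s\<close> to \<open>z\<close> whose inner vertices are the
  intervals covering that segment, so a separator is the same as a cover.

  Polynomial time is handled by closure properties of a class of total functions on S-expressions.
  The one recursion scheme is a fold over a list whose accumulator grows at each step by an amount
  that does not depend on the accumulator; this makes its size polynomial on every input, not only
  on valid codes.
\<close>

section \<open>Polynomial-time functions on S-expressions\<close>

text \<open>Separate labels matter because the paths of different segments share vertices: in their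
  union a walk could switch from one path to another and avoid the chosen intervals. Within one
  snapshot a walk between the two ends of a simple path visits all of it, so any order of the inner
  vertices would do. A segment that no interval covers yields a direct edge from \<open>s\<close> to
  \<open>z\<close>; then neither problem has a solution. Intervals and inner vertices correspond one
  to one, so sizes agree, and both the bound \<open>k\<close> and optimality carry over.

  Valid codes are duplicate-free lists, so the edges must be listed without repetition, which takes
  its own argument. On the machine side the obstacle is composition: \<open>poly_time_on\<close>
  says nothing about leftover registers, and intermediate values need not satisfy any promise. Hence
  a stronger notion, over arbitrary inputs, is composed, and a promise enters only at the
  end.\<close>

lemma poly_nat_mono: "m \<le> n \<Longrightarrow> poly p m \<le> poly p (n :: nat)"
  by (induction p) (auto intro: add_mono mult_mono)

lemma floorlog_2_0 [simp]: "floorlog 2 0 = 0"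
  by (simp add: floorlog_def)

lemma floorlog_2_Suc_0 [simp]: "floorlog 2 (Suc 0) = 1"
  by (simp add: floorlog_def)

lemma size_sexp_pos [simp]: "0 < size_sexp v"
  by (cases v) auto

lemma size_car_le: "size_sexp (car v) \<le> size_sexp v"
  by (cases v) auto

lemma size_cdr_le: "size_sexp (cdr v) \<le> size_sexp v"
  by (cases v) auto

lemma size_atom_val_le: "size_sexp (Atom (atom_val v)) \<le> size_sexp v"
  by (cases v) auto

lemma less_2_power_floorlog: "a < 2 ^ floorlog 2 a"
  using floorlog_bounds[of a 2] by (cases "a = 0") auto

lemma floorlog_add_le: "floorlog 2 (a + b) \<le> Suc (floorlog 2 a + floorlog 2 b)"
proof -
  let ?x = "2 ^ floorlog 2 a :: nat" and ?y = "2 ^ floorlog 2 b :: nat"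
  have bounds: "a < ?x" "b < ?y"
    by (rule less_2_power_floorlog)+
  have "?x * 1 \<le> ?x * ?y" "1 * ?y \<le> ?x * ?y"
    by (intro mult_mono; simp)+
  hence "a + b < 2 * (?x * ?y)"
    using bounds by linarith
  thus ?thesis
    by (simp add: floorlog_le_iff power_add)
qed

lemma floorlog_mult_le: "floorlog 2 (a * b) \<le> floorlog 2 a + floorlog 2 b"
proof -
  have "a < 2 ^ floorlog 2 a" "b < 2 ^ floorlog 2 b"
    by (rule less_2_power_floorlog)+
  hence "a * b < 2 ^ floorlog 2 a * 2 ^ floorlog 2 b"
    by (intro mult_strict_mono) auto
  thus ?thesis
    by (simp add: floorlog_le_iff power_add)
qed

text \<open>The extra unit of \<open>floorlog_add_le\<close>, the carry, is paid by the tag 1 that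
  each of the two atoms contributes to the right-hand side.\<close>

lemma size_Atom_add_le: "size_sexp (Atom (i + j)) \<le> size_sexp (Atom i) + size_sexp (Atom j)"
proof -
  have "floorlog 2 (nat \<bar>i + j\<bar>) \<le> floorlog 2 (nat \<bar>i\<bar> + nat \<bar>j\<bar>)"
    by (intro floorlog_mono) auto
  also note floorlog_add_le
  finally show ?thesis by simp
qed

lemma size_Atom_mult_le: "size_sexp (Atom (i * j)) \<le> size_sexp (Atom i) + size_sexp (Atom j)"
  using floorlog_mult_le[of "nat \<bar>i\<bar>" "nat \<bar>j\<bar>"]
  by (simp add: abs_mult nat_mult_distrib)

section \<open>Executions with an upper bound on the running time\<close>

definition exec_le :: "prog \<Rightarrow> store \<Rightarrow> nat \<Rightarrow> store \<Rightarrow> bool" where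
  "exec_le c \<sigma> b \<sigma>' \<longleftrightarrow> (\<exists>n\<le>b. exec c \<sigma> n \<sigma>')"

lemma exec_le_mono: "exec_le c \<sigma> b \<sigma>' \<Longrightarrow> b \<le> b' \<Longrightarrow> exec_le c \<sigma> b' \<sigma>'"
  by (auto simp: exec_le_def intro: order_trans)

lemma exec_le_Assign:
  "\<sigma>' = \<sigma>(x := val_of a \<sigma>) \<Longrightarrow> 1 + expr_cost a \<sigma> \<le> b \<Longrightarrow> exec_le (Assign x a) \<sigma> b \<sigma>'"
  unfolding exec_le_def by (metis exec.Assign)

lemma exec_le_Seq:
  "exec_le c \<sigma> m \<sigma>' \<Longrightarrow> exec_le d \<sigma>' n \<sigma>'' \<Longrightarrow> exec_le (Seq c d) \<sigma> (m + n) \<sigma>''"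
  unfolding exec_le_def by (meson add_mono exec.Seq)

lemma exec_le_If:
  assumes "val_of a \<sigma> \<noteq> Atom 0 \<Longrightarrow> exec_le c \<sigma> n \<sigma>'" "val_of a \<sigma> = Atom 0 \<Longrightarrow> exec_le d \<sigma> n \<sigma>'"
  shows "exec_le (If a c d) \<sigma> (1 + expr_cost a \<sigma> + n) \<sigma>'"
proof (cases "val_of a \<sigma> = Atom 0")
  case True
  then obtain k where "k \<le> n" "exec d \<sigma> k \<sigma>'"
    using assms(2) by (auto simp: exec_le_def)
  thus ?thesis
    unfolding exec_le_def using exec.If_false[OF True] by (metis add_le_cancel_left)
next
  case False
  then obtain k where "k \<le> n" "exec c \<sigma> k \<sigma>'"
    using assms(1) by (auto simp: exec_le_def)
  thus ?thesis
    unfolding exec_le_def using exec.If_true[OF False] by (metis add_le_cancel_left)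
qed

lemma exec_le_While_false:
  "val_of a \<sigma> = Atom 0 \<Longrightarrow> exec_le (While a c) \<sigma> (1 + expr_cost a \<sigma>) \<sigma>"
  unfolding exec_le_def by (meson exec.While_false order_refl)

lemma exec_le_While_true:
  assumes "val_of a \<sigma> \<noteq> Atom 0" "exec_le c \<sigma> m \<sigma>'" "exec_le (While a c) \<sigma>' n \<sigma>''"
  shows "exec_le (While a c) \<sigma> (1 + expr_cost a \<sigma> + m + n) \<sigma>''"
  using assms unfolding exec_le_def by (meson add_mono order_refl exec.While_true)

lemma size_le_expr_cost: "size_sexp (val_of a \<sigma>) \<le> expr_cost a \<sigma>"
  by (cases a) auto

text \<open>Every assigned value has been charged its size in bits, so no register can gain more
  than the elapsed time. This is where the logarithmic cost criterion enters.\<close>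

lemma exec_size_le: "exec c \<sigma> n \<sigma>' \<Longrightarrow> size_sexp (\<sigma>' x) \<le> size_sexp (\<sigma> x) + n"
proof (induction rule: exec.induct)
  case (Assign y a \<sigma>)
  show ?case using size_le_expr_cost[of a \<sigma>] by auto
qed auto

text \<open>The scratch registers below \<open>N\<close> are reset at the end and all others are untouched, so that
  such programs can be composed without any analysis of the variables occurring in them.\<close>

definition computes_within :: "prog \<Rightarrow> nat \<Rightarrow> (sexp \<Rightarrow> sexp) \<Rightarrow> nat poly \<Rightarrow> bool" where
  "computes_within c N f p \<longleftrightarrow>
    (\<forall>\<sigma>. (\<forall>i. 0 < i \<and> i < N \<longrightarrow> \<sigma> i = Atom 0) \<longrightarrow>
      exec_le c \<sigma> (poly p (size_sexp (\<sigma> 0))) (\<sigma>(0 := f (\<sigma> 0))))"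

definition ptime :: "(sexp \<Rightarrow> sexp) \<Rightarrow> bool" where
  "ptime f \<longleftrightarrow> (\<exists>c N p. computes_within c N f p)"

text \<open>The free \<open>k\<close> and the equation for \<open>\<sigma>'\<close> let a composite
  program supply its own size bound and its own normal form of the store.\<close>

lemma computes_withinD:
  assumes "computes_within c N f p" "\<And>i. 0 < i \<Longrightarrow> i < N \<Longrightarrow> \<sigma> i = Atom 0"
    "size_sexp (\<sigma> 0) \<le> k" "\<sigma>' = \<sigma>(0 := f (\<sigma> 0))"
  shows "exec_le c \<sigma> (poly p k) \<sigma>'"
  using assms poly_nat_mono[of "size_sexp (\<sigma> 0)" k p]
  unfolding computes_within_def by (auto intro: exec_le_mono)

lemma poly_time_on_if_ptime:
  assumes "ptime f"
  shows "poly_time_on D f"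
proof -
  obtain c N p where c: "computes_within c N f p"
    using assms by (auto simp: ptime_def)
  have "\<exists>n \<sigma>. exec c (init_store v) n \<sigma> \<and> \<sigma> 0 = f v \<and> n \<le> poly p (size_sexp v)" for v
    using computes_withinD[OF c, of "init_store v" "size_sexp v"]
    by (fastforce simp: init_store_def exec_le_def)
  thus ?thesis
    unfolding poly_time_on_def by blast
qed

lemma ptime_size:
  assumes "ptime f"
  shows "\<exists>p. \<forall>v. size_sexp (f v) \<le> poly p (size_sexp v)"
proof -
  obtain c N p where c: "computes_within c N f p"
    using assms by (auto simp: ptime_def)
  have "size_sexp (f v) \<le> poly ([:0, 1:] + p) (size_sexp v)" for v
  proof -
    obtain n where n: "n \<le> poly p (size_sexp v)"
        "exec c (init_store v) n ((init_store v)(0 := f v))"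
      using computes_withinD[OF c, of "init_store v" "size_sexp v"]
      by (fastforce simp: init_store_def exec_le_def)
    from exec_size_le[OF n(2), of 0] n(1) show ?thesis
      by (simp add: init_store_def)
  qed
  thus ?thesis by blast
qed

section \<open>Closure properties of \<open>ptime\<close>\<close>

lemma ptime_expr:
  assumes "\<And>\<sigma>. val_of a \<sigma> = f (\<sigma> 0)" "\<And>\<sigma>. expr_cost a \<sigma> \<le> k * size_sexp (\<sigma> 0) + k"
  shows "ptime f"
proof -
  have "computes_within (Assign 0 a) 0 f [:1 + k, k:]"
    unfolding computes_within_def
  proof (intro allI impI exec_le_Assign)
    fix \<sigma> show "\<sigma>(0 := f (\<sigma> 0)) = \<sigma>(0 := val_of a \<sigma>)" using assms(1) by simp
    show "1 + expr_cost a \<sigma> \<le> poly [:1 + k, k:] (size_sexp (\<sigma> 0))"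
      using assms(2)[of \<sigma>] by (simp add: mult.commute)
  qed
  thus ?thesis unfolding ptime_def by blast
qed

lemma ptime_comp:
  assumes "ptime g" "ptime f"
  shows "ptime (\<lambda>v. g (f v))"
proof -
  obtain c N p d M q r where c: "computes_within c N f p" and d: "computes_within d M g q"
    and r: "\<And>v. size_sexp (f v) \<le> poly r (size_sexp v)"
    using assms ptime_size[OF assms(2)] unfolding ptime_def by metis
  \<comment> \<open>Since \<open>c\<close> resets its scratch registers, \<open>d\<close> starts as
    if from a fresh store; its input has size at most \<open>poly r\<close>, whence the composed
    polynomial.\<close>
  have "computes_within (Seq c d) (max N M) (\<lambda>v. g (f v)) (p + q \<circ>\<^sub>p r)"
    unfolding computes_within_def poly_add poly_pcompose
    by (auto intro!: exec_le_Seq computes_withinD[OF c] computes_withinD[OF d] r)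
  thus ?thesis unfolding ptime_def by blast
qed

lemma ptime_id: "ptime (\<lambda>v. v)"
  by (rule ptime_expr[of "Var 0" _ 1]) auto

lemma ptime_Atom: "ptime (\<lambda>v. Atom i)"
  by (rule ptime_expr[of "Lit i" _ "size_sexp (Atom i)"]) auto

lemma ptime_Cell:
  assumes "ptime f" "ptime g"
  shows "ptime (\<lambda>v. Cell (f v) (g v))"
proof -
  obtain c N p d M q r r' where c: "computes_within c N f p" and d: "computes_within d M g q"
    and r: "\<And>v. size_sexp (f v) \<le> poly r (size_sexp v)"
    and r': "\<And>v. size_sexp (g v) \<le> poly r' (size_sexp v)"
    using assms ptime_size[OF assms(1)] ptime_size[OF assms(2)] unfolding ptime_def by metis
  \<comment> \<open>Registers \<open>K\<close> and \<open>Suc K\<close> lie above the scratch space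
    of both programs, so the saved input and the saved first result survive the runs of
    \<open>c\<close> and \<open>d\<close>.\<close>
  define K where "K = Suc (max N M)"
  have K: "N < K" "M < K" "0 < K" by (auto simp: K_def)
  define prog where "prog =
    Seq (Assign K (Var 0)) (Seq c (Seq (Assign (Suc K) (Var 0)) (Seq (Assign 0 (Var K)) (Seq d
      (Seq (Assign 0 (Cons_of (Var (Suc K)) (Var 0)))
      (Seq (Assign K (Lit 0)) (Assign (Suc K) (Lit 0))))))))"
  \<comment> \<open>One summand for each of the eight commands; a reset costs 2, namely 1 for the
    assignment and 1 for the size of \<open>Atom 0\<close>.\<close>
  define t where "t = [:1, 1:] + (p + ((1 + r) + ([:1, 1:] + (q + ((2 + 2 * r + 2 * r') + (2 + 2))))))"
  have "computes_within prog (Suc (Suc K)) (\<lambda>v. Cell (f v) (g v)) t"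
    unfolding computes_within_def
  proof (intro allI impI)
    fix \<sigma> :: store assume zero: "\<forall>i. 0 < i \<and> i < Suc (Suc K) \<longrightarrow> \<sigma> i = Atom 0"
    let ?v = "\<sigma> 0" let ?s = "size_sexp ?v"
    have 1: "exec_le (Assign K (Var 0)) \<sigma> (poly [:1, 1:] ?s) (\<sigma>(K := ?v))"
      by (rule exec_le_Assign) auto
    have 2: "exec_le c (\<sigma>(K := ?v)) (poly p ?s) (\<sigma>(K := ?v, 0 := f ?v))"
      by (rule computes_withinD[OF c]) (use K zero in auto)
    have 3: "exec_le (Assign (Suc K) (Var 0)) (\<sigma>(K := ?v, 0 := f ?v)) (poly (1 + r) ?s)
        (\<sigma>(K := ?v, 0 := f ?v, Suc K := f ?v))"
      by (rule exec_le_Assign) (use r[of ?v] in auto)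
    have 4: "exec_le (Assign 0 (Var K)) (\<sigma>(K := ?v, 0 := f ?v, Suc K := f ?v)) (poly [:1, 1:] ?s)
        (\<sigma>(K := ?v, Suc K := f ?v, 0 := ?v))"
      by (rule exec_le_Assign) (use K in auto)
    have 5: "exec_le d (\<sigma>(K := ?v, Suc K := f ?v, 0 := ?v)) (poly q ?s)
        (\<sigma>(K := ?v, Suc K := f ?v, 0 := g ?v))"
      by (rule computes_withinD[OF d]) (use K zero in auto)
    have 6: "exec_le (Assign 0 (Cons_of (Var (Suc K)) (Var 0)))
        (\<sigma>(K := ?v, Suc K := f ?v, 0 := g ?v)) (poly (2 + 2 * r + 2 * r') ?s)
        (\<sigma>(K := ?v, Suc K := f ?v, 0 := Cell (f ?v) (g ?v)))"
      by (rule exec_le_Assign) (use r[of ?v] r'[of ?v] in auto)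
    have 7: "exec_le (Assign K (Lit 0))
        (\<sigma>(K := ?v, Suc K := f ?v, 0 := Cell (f ?v) (g ?v))) (poly 2 ?s)
        (\<sigma>(Suc K := f ?v, 0 := Cell (f ?v) (g ?v)))"
      by (rule exec_le_Assign) (use K zero in \<open>auto simp: fun_eq_iff\<close>)
    have 8: "exec_le (Assign (Suc K) (Lit 0))
        (\<sigma>(Suc K := f ?v, 0 := Cell (f ?v) (g ?v))) (poly 2 ?s) (\<sigma>(0 := Cell (f ?v) (g ?v)))"
      by (rule exec_le_Assign) (use K zero in \<open>auto simp: fun_eq_iff\<close>)
    show "exec_le prog \<sigma> (poly t ?s) (\<sigma>(0 := Cell (f ?v) (g ?v)))"
      unfolding prog_def
      by (rule exec_le_mono[OF exec_le_Seq[OF 1 exec_le_Seq[OF 2 exec_le_Seq[OF 3 exec_le_Seq[OF 4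
          exec_le_Seq[OF 5 exec_le_Seq[OF 6 exec_le_Seq[OF 7 8]]]]]]]]) (simp add: t_def)
  qed
  thus ?thesis unfolding ptime_def by blast
qed

lemma ptime_unary:
  assumes "\<And>v. size_sexp (F v) \<le> 2 * size_sexp v + 2"
    "\<And>a \<sigma>. val_of (E a) \<sigma> = F (val_of a \<sigma>)"
    "\<And>a \<sigma>. expr_cost (E a) \<sigma> = expr_cost a \<sigma> + size_sexp (F (val_of a \<sigma>))"
    and "ptime f"
  shows "ptime (\<lambda>v. F (f v))"
  using _ assms(4)
proof (rule ptime_comp)
  show "ptime F"
  proof (rule ptime_expr[of "E (Var 0)" _ 3])
    show "expr_cost (E (Var 0)) \<sigma> \<le> 3 * size_sexp (\<sigma> 0) + 3" for \<sigma>
      using assms(1)[of "\<sigma> 0"] by (simp add: assms(3))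
  qed (simp add: assms(2))
qed

lemma ptime_car: "ptime f \<Longrightarrow> ptime (\<lambda>v. car (f v))"
  by (rule ptime_unary[where E = Car and F = car]) (auto intro: order.trans[OF size_car_le])

lemma ptime_cdr: "ptime f \<Longrightarrow> ptime (\<lambda>v. cdr (f v))"
  by (rule ptime_unary[where E = Cdr and F = cdr]) (auto intro: order.trans[OF size_cdr_le])

abbreviation truth :: "bool \<Rightarrow> sexp" where
  "truth b \<equiv> Atom (if b then 1 else 0)"

lemma ptime_is_cell: "ptime f \<Longrightarrow> ptime (\<lambda>v. truth (is_cell (f v)))"
  by (rule ptime_unary[where E = Is_cell and F = "\<lambda>v. truth (is_cell v)"]) auto

text \<open>Two arguments are reduced to one by pairing: the operation is performed on the
  components of a cell, and the cell is built by \<open>ptime_Cell\<close>.\<close>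

lemma ptime_binary:
  assumes "\<And>x y. size_sexp (F x y) \<le> size_sexp x + size_sexp y + 2"
    "\<And>a b \<sigma>. val_of (E a b) \<sigma> = F (val_of a \<sigma>) (val_of b \<sigma>)"
    "\<And>a b \<sigma>. expr_cost (E a b) \<sigma> =
      expr_cost a \<sigma> + expr_cost b \<sigma> + size_sexp (F (val_of a \<sigma>) (val_of b \<sigma>))"
    and "ptime f" "ptime g"
  shows "ptime (\<lambda>v. F (f v) (g v))"
proof -
  have "ptime (\<lambda>v. F (car v) (cdr v))"
  proof (rule ptime_expr[of "E (Car (Var 0)) (Cdr (Var 0))" _ 6])
    fix \<sigma>
    show "expr_cost (E (Car (Var 0)) (Cdr (Var 0))) \<sigma> \<le> 6 * size_sexp (\<sigma> 0) + 6"
      using assms(1)[of "car (\<sigma> 0)" "cdr (\<sigma> 0)"] size_car_le[of "\<sigma> 0"] size_cdr_le[of "\<sigma> 0"]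
      by (simp add: assms(3))
  qed (simp add: assms(2))
  from ptime_comp[OF this ptime_Cell[OF assms(4,5)]] show ?thesis by simp
qed

definition s_plus :: "sexp \<Rightarrow> sexp \<Rightarrow> sexp" where
  "s_plus x y = Atom (atom_val x + atom_val y)"

definition s_times :: "sexp \<Rightarrow> sexp \<Rightarrow> sexp" where
  "s_times x y = Atom (atom_val x * atom_val y)"

definition s_le :: "sexp \<Rightarrow> sexp \<Rightarrow> sexp" where
  "s_le x y = truth (atom_val x \<le> atom_val y)"

definition s_if :: "sexp \<Rightarrow> sexp \<Rightarrow> sexp \<Rightarrow> sexp" where
  "s_if b x y = (if b = Atom 0 then y else x)"

lemma size_s_plus_le: "size_sexp (s_plus x y) \<le> size_sexp x + size_sexp y"
  using size_Atom_add_le[of "atom_val x" "atom_val y"] size_atom_val_le[of x] size_atom_val_le[of y]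
  unfolding s_plus_def by linarith

lemma size_s_times_le: "size_sexp (s_times x y) \<le> size_sexp x + size_sexp y"
  using size_Atom_mult_le[of "atom_val x" "atom_val y"] size_atom_val_le[of x] size_atom_val_le[of y]
  unfolding s_times_def by linarith

lemma ptime_s_plus: "ptime f \<Longrightarrow> ptime g \<Longrightarrow> ptime (\<lambda>v. s_plus (f v) (g v))"
  by (rule ptime_binary[where E = Plus and F = s_plus, OF trans_le_add1[OF size_s_plus_le]])
    (auto simp: s_plus_def)

lemma ptime_s_times: "ptime f \<Longrightarrow> ptime g \<Longrightarrow> ptime (\<lambda>v. s_times (f v) (g v))"
  by (rule ptime_binary[where E = Times and F = s_times, OF trans_le_add1[OF size_s_times_le]])
    (auto simp: s_times_def)

lemma ptime_s_le: "ptime f \<Longrightarrow> ptime g \<Longrightarrow> ptime (\<lambda>v. s_le (f v) (g v))"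
  by (rule ptime_binary[where E = Leq and F = s_le]) (auto simp: s_le_def)

lemma ptime_s_if:
  assumes "ptime b" "ptime f" "ptime g"
  shows "ptime (\<lambda>v. s_if (b v) (f v) (g v))"
proof -
  obtain c N p d M q where c: "computes_within c N f p" and d: "computes_within d M g q"
    using assms(2,3) by (auto simp: ptime_def)
  let ?drop = "Assign 0 (Cdr (Var 0))"
  \<comment> \<open>The test value travels in front of the original input, so that the branch can be
    chosen before \<open>?drop\<close> restores the input for the selected program. The common bound
    \<open>p + q\<close> serves either branch.\<close>
  let ?h = "\<lambda>w. s_if (car w) (f (cdr w)) (g (cdr w))"
  have "computes_within (If (Car (Var 0)) (Seq ?drop c) (Seq ?drop d)) (max N M) ?h
      ([:1, 2:] + ([:1, 2:] + (p + q)))"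
    unfolding computes_within_def
  proof (intro allI impI)
    fix \<sigma> :: store assume zero: "\<forall>i. 0 < i \<and> i < max N M \<longrightarrow> \<sigma> i = Atom 0"
    let ?w = "\<sigma> 0" let ?s = "size_sexp ?w"
    have drop: "exec_le ?drop \<sigma> (poly [:1, 2:] ?s) (\<sigma>(0 := cdr ?w))"
      by (rule exec_le_Assign) (use size_cdr_le[of ?w] in auto)
    have c': "exec_le c (\<sigma>(0 := cdr ?w)) (poly (p + q) ?s) (\<sigma>(0 := f (cdr ?w)))"
      by (rule exec_le_mono[OF computes_withinD[OF c]])
        (use zero size_cdr_le[of ?w] in auto)
    have d': "exec_le d (\<sigma>(0 := cdr ?w)) (poly (p + q) ?s) (\<sigma>(0 := g (cdr ?w)))"
      by (rule exec_le_mono[OF computes_withinD[OF d]])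
        (use zero size_cdr_le[of ?w] in auto)
    show "exec_le (If (Car (Var 0)) (Seq ?drop c) (Seq ?drop d)) \<sigma>
        (poly ([:1, 2:] + ([:1, 2:] + (p + q))) ?s) (\<sigma>(0 := ?h ?w))"
    proof (rule exec_le_mono[OF exec_le_If])
      show "1 + expr_cost (Car (Var 0)) \<sigma> + (poly [:1, 2:] ?s + poly (p + q) ?s)
          \<le> poly ([:1, 2:] + ([:1, 2:] + (p + q))) ?s"
        using size_car_le[of ?w] by simp
    qed (use exec_le_Seq[OF drop c'] exec_le_Seq[OF drop d'] in \<open>auto simp: s_if_def\<close>)
  qed
  hence "ptime ?h" unfolding ptime_def by blast
  from ptime_comp[OF this ptime_Cell[OF assms(1) ptime_id]] show ?thesis by simp
qed

section \<open>Folds over lists in polynomial time\<close>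

text \<open>The step function sees the whole remaining list, not only its first element: its length serves
  as a running index, which thus need not be part of the accumulator.\<close>

fun s_fold :: "(sexp \<Rightarrow> sexp \<Rightarrow> sexp \<Rightarrow> sexp) \<Rightarrow> sexp \<Rightarrow> sexp \<Rightarrow> sexp \<Rightarrow> sexp" where
  "s_fold h (Atom i) a e = a"
| "s_fold h (Cell x l) a e = s_fold h l (h (Cell x l) a e) e"

definition additive :: "(sexp \<Rightarrow> sexp \<Rightarrow> sexp \<Rightarrow> sexp) \<Rightarrow> bool" where
  "additive h \<longleftrightarrow>
    (\<exists>q. \<forall>l a e. size_sexp (h l a e) \<le> size_sexp a + poly q (size_sexp l + size_sexp e))"

text \<open>The bound \<open>k\<close> on the initial list stays fixed while the list shrinks, so
  every step is charged the same increment, and \<open>size_sexp l\<close> bounds the number of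
  steps.\<close>

lemma size_s_fold_le:
  assumes "\<And>l a e. size_sexp (h l a e) \<le> size_sexp a + poly q (size_sexp l + size_sexp e)"
    and "size_sexp l \<le> k"
  shows "size_sexp (s_fold h l a e) \<le> size_sexp a + size_sexp l * poly q (k + size_sexp e)"
  using assms(2)
proof (induction l arbitrary: a)
  case (Cell x l)
  let ?G = "poly q (k + size_sexp e)"
  have "size_sexp (h (Cell x l) a e) \<le> size_sexp a + ?G"
    using assms(1)[of "Cell x l" a e] Cell.prems
      poly_nat_mono[of "size_sexp (Cell x l) + size_sexp e" "k + size_sexp e" q] by simp
  moreover have "size_sexp (s_fold h l (h (Cell x l) a e) e)
      \<le> size_sexp (h (Cell x l) a e) + size_sexp l * ?G"
    using Cell by simp
  ultimately show ?case by (simp add: algebra_simps)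
qed simp

text \<open>\<open>L\<close> and \<open>A\<close> are budgets that stay fixed during the loop. The
  last premise is the invariant: the accumulator together with all growth still to come fits into
  \<open>A\<close>; a step moves one increment from the second summand to the first.
  \<open>X\<close> bounds the cell handed to \<open>c\<close>. The final \<open>Atom i\<close> is
  whatever atom ends the list.\<close>

lemma s_fold_loop:
  fixes h c p q K L A e
  defines "W \<equiv> While (Is_cell (Var K))
    (Seq (Assign 0 (Cons_of (Var K) (Cons_of (Var 0) (Var (Suc K))))) (Seq c (Assign K (Cdr (Var K)))))"
    and "X \<equiv> 2 + L + A + size_sexp e"
  assumes c: "computes_within c N (\<lambda>w. h (car w) (car (cdr w)) (cdr (cdr w))) p"
    and K: "N \<le> K" "0 < K"
    and h: "\<And>l a e. size_sexp (h l a e) \<le> size_sexp a + poly q (size_sexp l + size_sexp e)"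
    and "\<And>i. 0 < i \<Longrightarrow> i < K \<Longrightarrow> \<sigma> i = Atom 0"
    and "\<sigma> 0 = a" "\<sigma> K = l" "\<sigma> (Suc K) = e"
    and "size_sexp l \<le> L" "size_sexp a + size_sexp l * poly q (L + size_sexp e) \<le> A"
  shows "\<exists>i. exec_le W \<sigma> (size_sexp l * (poly p X + 10 * X)) (\<sigma>(0 := s_fold h l a e, K := Atom i))"
  using assms(7-)
proof (induction l arbitrary: a \<sigma>)
  case (Atom j)
  have "exec_le W \<sigma> (1 + expr_cost (Is_cell (Var K)) \<sigma>) \<sigma>"
    unfolding W_def by (rule exec_le_While_false) (use Atom in auto)
  moreover have "1 + expr_cost (Is_cell (Var K)) \<sigma> \<le> 1 * (10 * X)"
    using Atom.prems(3,5) by (simp add: X_def)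
  \<comment> \<open>The terminating atom has size at least 1, which pays for the last, failing
    test.\<close>
  moreover have "1 * (10 * X) \<le> size_sexp (Atom j) * (poly p X + 10 * X)"
    by (intro mult_mono) auto
  ultimately have "exec_le W \<sigma> (size_sexp (Atom j) * (poly p X + 10 * X)) \<sigma>"
    by (meson exec_le_mono le_trans)
  moreover have "\<sigma>(0 := s_fold h (Atom j) a e, K := Atom j) = \<sigma>"
    using Atom.prems(2,3) K by auto
  ultimately show ?case by metis
next
  case (Cell x l)
  let ?l = "Cell x l" and ?G = "poly q (L + size_sexp e)"
  let ?a = "h ?l a e"
  let ?\<sigma>1 = "\<sigma>(0 := Cell ?l (Cell a e))" and ?\<sigma>2 = "\<sigma>(0 := ?a)"
  let ?\<sigma>3 = "\<sigma>(0 := ?a, K := l)"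
  note eqs = Cell.prems(2-4)
  have a: "size_sexp a \<le> A"
    using Cell.prems(6) by simp
  have "size_sexp ?a \<le> size_sexp a + ?G"
    using h[of ?l a e] Cell.prems(5) poly_nat_mono[of "size_sexp ?l + size_sexp e" "L + size_sexp e" q]
    by simp
  hence a': "size_sexp ?a + size_sexp l * ?G \<le> A"
    using Cell.prems(6) by (simp add: algebra_simps)
  have "exec_le (Assign 0 (Cons_of (Var K) (Cons_of (Var 0) (Var (Suc K))))) \<sigma> (5 * X) ?\<sigma>1"
    by (rule exec_le_Assign) (use eqs a Cell.prems(5) in \<open>auto simp: X_def\<close>)
  moreover have "exec_le c ?\<sigma>1 (poly p X) ?\<sigma>2"
    by (rule computes_withinD[OF c]) (use Cell.prems(1,5) K a in \<open>auto simp: X_def\<close>)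
  moreover have "exec_le (Assign K (Cdr (Var K))) ?\<sigma>2 (2 * X) ?\<sigma>3"
    by (rule exec_le_Assign) (use eqs K Cell.prems(5) in \<open>auto simp: X_def\<close>)
  ultimately have body: "exec_le (Seq (Assign 0 (Cons_of (Var K) (Cons_of (Var 0) (Var (Suc K)))))
      (Seq c (Assign K (Cdr (Var K))))) \<sigma> (5 * X + (poly p X + 2 * X)) ?\<sigma>3"
    by (intro exec_le_Seq)
  have "\<exists>i. exec_le W ?\<sigma>3 (size_sexp l * (poly p X + 10 * X)) (?\<sigma>3(0 := s_fold h l ?a e, K := Atom i))"
    by (rule Cell.IH(2)) (use Cell.prems(1,4,5) K a' in auto)
  then obtain i where rest: "exec_le W ?\<sigma>3 (size_sexp l * (poly p X + 10 * X))
      (\<sigma>(0 := s_fold h l ?a e, K := Atom i))"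
    by (auto simp: fun_upd_twist)
  have "exec_le W \<sigma> (1 + expr_cost (Is_cell (Var K)) \<sigma> + (5 * X + (poly p X + 2 * X))
      + size_sexp l * (poly p X + 10 * X)) (\<sigma>(0 := s_fold h l ?a e, K := Atom i))"
    using eqs exec_le_While_true[OF _ body rest[unfolded W_def]] by (simp add: W_def)
  \<comment> \<open>The factor 10 is composed of 3 for the test, 5 for packing the arguments and 2
    for advancing the list.\<close>
  moreover have "1 + expr_cost (Is_cell (Var K)) \<sigma> \<le> 3 * X"
    using eqs Cell.prems(5) by (simp add: X_def)
  hence "1 + expr_cost (Is_cell (Var K)) \<sigma> + (5 * X + (poly p X + 2 * X))
      + size_sexp l * (poly p X + 10 * X) \<le> size_sexp ?l * (poly p X + 10 * X)"
    by (simp add: algebra_simps)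
  ultimately have "exec_le W \<sigma> (size_sexp ?l * (poly p X + 10 * X))
      (\<sigma>(0 := s_fold h l ?a e, K := Atom i))"
    by (rule exec_le_mono)
  thus ?case unfolding s_fold.simps by (rule exI)
qed

lemma ptime_s_fold:
  assumes "ptime l" "ptime a" "ptime e"
    and "ptime (\<lambda>w. h (car w) (car (cdr w)) (cdr (cdr w)))" and "additive h"
  shows "ptime (\<lambda>v. s_fold h (l v) (a v) (e v))"
proof -
  obtain c N p where c: "computes_within c N (\<lambda>w. h (car w) (car (cdr w)) (cdr (cdr w))) p"
    using assms(4) by (auto simp: ptime_def)
  obtain q where q: "\<And>l a e. size_sexp (h l a e) \<le> size_sexp a + poly q (size_sexp l + size_sexp e)"
    using assms(5) by (auto simp: additive_def)
  define K where "K = Suc N"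
  have K: "N \<le> K" "0 < K" by (auto simp: K_def)
  let ?H = "\<lambda>w. s_fold h (car w) (car (cdr w)) (cdr (cdr w))"
  let ?W = "While (Is_cell (Var K))
    (Seq (Assign 0 (Cons_of (Var K) (Cons_of (Var 0) (Var (Suc K))))) (Seq c (Assign K (Cdr (Var K)))))"
  define prog where "prog =
    Seq (Assign K (Car (Var 0))) (Seq (Assign (Suc K) (Cdr (Cdr (Var 0))))
      (Seq (Assign 0 (Car (Cdr (Var 0)))) (Seq ?W (Seq (Assign K (Lit 0)) (Assign (Suc K) (Lit 0))))))"
  define x :: "nat poly" where "x = [:0, 1:]"
  \<comment> \<open>List, initial accumulator and environment are parts of one input of size
    \<open>x\<close>; hence \<open>2 * x\<close> bounds list and environment together.\<close>
  define A where "A = x + x * q \<circ>\<^sub>p (2 * x)"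
  define X where "X = 2 + x + A + x"
  have [simp]: "poly x k = k" for k by (simp add: x_def)
  have X: "poly X k = 2 + k + poly A k + k" for k by (simp add: X_def)
  define t where "t = [:1, 3:] + ([:1, 3:] + ([:1, 3:] + (x * (p \<circ>\<^sub>p X + 10 * X) + (2 + 2))))"
  have "computes_within prog (Suc (Suc K)) ?H t"
    unfolding computes_within_def
  proof (intro allI impI)
    fix \<sigma> :: store assume zero: "\<forall>i. 0 < i \<and> i < Suc (Suc K) \<longrightarrow> \<sigma> i = Atom 0"
    define v where "v = \<sigma> 0"
    define s where "s = size_sexp v"
    have sizes: "size_sexp (car v) \<le> s" "size_sexp (cdr v) \<le> s"
        "size_sexp (car (cdr v)) \<le> s" "size_sexp (cdr (cdr v)) \<le> s"
      using size_car_le[of v] size_cdr_le[of v] size_car_le[of "cdr v"] size_cdr_le[of "cdr v"]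
      by (simp_all add: s_def)
    let ?\<sigma>1 = "\<sigma>(K := car v)"
    let ?\<sigma>2 = "\<sigma>(K := car v, Suc K := cdr (cdr v))"
    let ?\<sigma>3 = "\<sigma>(K := car v, Suc K := cdr (cdr v), 0 := car (cdr v))"
    have 1: "exec_le (Assign K (Car (Var 0))) \<sigma> (poly [:1, 3:] s) ?\<sigma>1"
      by (rule exec_le_Assign) (use sizes in \<open>auto simp: v_def[symmetric] s_def[symmetric]\<close>)
    have 2: "exec_le (Assign (Suc K) (Cdr (Cdr (Var 0)))) ?\<sigma>1 (poly [:1, 3:] s) ?\<sigma>2"
      by (rule exec_le_Assign) (use sizes K in \<open>auto simp: v_def[symmetric] s_def[symmetric]\<close>)
    have 3: "exec_le (Assign 0 (Car (Cdr (Var 0)))) ?\<sigma>2 (poly [:1, 3:] s) ?\<sigma>3"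
      by (rule exec_le_Assign) (use sizes K in \<open>auto simp: v_def[symmetric] s_def[symmetric]\<close>)
    have G: "poly q (s + size_sexp (cdr (cdr v))) \<le> poly q (2 * s)"
      using sizes by (intro poly_nat_mono) auto
    have A: "size_sexp (car (cdr v)) + size_sexp (car v) * poly q (s + size_sexp (cdr (cdr v)))
        \<le> poly A s"
      unfolding A_def using sizes G
      by (simp add: poly_pcompose) (intro add_mono mult_mono; simp)
    obtain i where loop: "exec_le ?W ?\<sigma>3
        (size_sexp (car v) * (poly p (2 + s + poly A s + size_sexp (cdr (cdr v)))
          + 10 * (2 + s + poly A s + size_sexp (cdr (cdr v)))))
        (?\<sigma>3(0 := ?H v, K := Atom i))"
      using s_fold_loop[OF c K q, of ?\<sigma>3 "car (cdr v)" "car v" "cdr (cdr v)" s "poly A s"]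
        zero K A sizes by auto
    let ?\<sigma>4 = "\<sigma>(K := Atom i, Suc K := cdr (cdr v), 0 := ?H v)"
    have eq: "?\<sigma>3(0 := ?H v, K := Atom i) = ?\<sigma>4"
      using K by auto
    have le: "size_sexp (car v) * (poly p (2 + s + poly A s + size_sexp (cdr (cdr v)))
          + 10 * (2 + s + poly A s + size_sexp (cdr (cdr v))))
        \<le> poly (x * (p \<circ>\<^sub>p X + 10 * X)) s"
    proof -
      let ?y = "2 + s + poly A s + size_sexp (cdr (cdr v))"
      have y: "?y \<le> poly X s"
        using sizes by (simp add: X)
      have "poly p ?y + 10 * ?y \<le> poly p (poly X s) + 10 * poly X s"
        by (rule add_mono[OF poly_nat_mono[OF y] mult_le_mono2[OF y]])
      from mult_mono[OF sizes(1) this] show ?thesis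
        by (simp add: poly_pcompose)
    qed
    have 4: "exec_le ?W ?\<sigma>3 (poly (x * (p \<circ>\<^sub>p X + 10 * X)) s) ?\<sigma>4"
      by (rule exec_le_mono[OF loop[unfolded eq] le])
    have 5: "exec_le (Assign K (Lit 0)) ?\<sigma>4 (poly 2 s)
        (\<sigma>(Suc K := cdr (cdr v), 0 := ?H v))"
      by (rule exec_le_Assign) (use K zero in \<open>auto simp: fun_eq_iff\<close>)
    have 6: "exec_le (Assign (Suc K) (Lit 0)) (\<sigma>(Suc K := cdr (cdr v), 0 := ?H v)) (poly 2 s)
        (\<sigma>(0 := ?H v))"
      by (rule exec_le_Assign) (use K zero in \<open>auto simp: fun_eq_iff\<close>)
    have "exec_le prog \<sigma> (poly t s) (\<sigma>(0 := ?H v))"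
      unfolding prog_def
      by (rule exec_le_mono[OF exec_le_Seq[OF 1 exec_le_Seq[OF 2 exec_le_Seq[OF 3 exec_le_Seq[OF 4
          exec_le_Seq[OF 5 6]]]]]]) (simp add: t_def)
    thus "exec_le prog \<sigma> (poly t (size_sexp (\<sigma> 0))) (\<sigma>(0 := ?H (\<sigma> 0)))"
      by (simp add: v_def s_def)
  qed
  hence "ptime ?H" unfolding ptime_def by blast
  from ptime_comp[OF this ptime_Cell[OF assms(1) ptime_Cell[OF assms(2,3)]]] show ?thesis by simp
qed

lemmas ptime_intros = ptime_id ptime_Atom ptime_Cell ptime_car ptime_cdr ptime_is_cell
  ptime_s_plus ptime_s_times ptime_s_le ptime_s_if

text \<open>Both pushed elements are computed from \<open>Cell l e\<close>, without the accumulator.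
  The 2 counts the new cells, and \<open>[:1, 1:]\<close> gives the size of
  \<open>Cell l e\<close>.\<close>

lemma additive_push2:
  assumes "ptime (\<lambda>w. F (car w) (cdr w))" "ptime (\<lambda>w. G (car w) (cdr w))"
  shows "additive (\<lambda>l a e. s_if (B l e) (Cell (F l e) (Cell (G l e) a)) a)"
proof -
  obtain p q where p: "\<And>w. size_sexp (F (car w) (cdr w)) \<le> poly p (size_sexp w)"
    and q: "\<And>w. size_sexp (G (car w) (cdr w)) \<le> poly q (size_sexp w)"
    using assms[THEN ptime_size] by blast
  have "size_sexp (s_if (B l e) (Cell (F l e) (Cell (G l e) a)) a)
      \<le> size_sexp a + poly (2 + (p + q) \<circ>\<^sub>p [:1, 1:]) (size_sexp l + size_sexp e)" for l a e
    using p[of "Cell l e"] q[of "Cell l e"] by (simp add: s_if_def poly_pcompose)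
  thus ?thesis unfolding additive_def by blast
qed

lemma additive_push:
  assumes "ptime (\<lambda>w. F (car w) (cdr w))"
  shows "additive (\<lambda>l a e. s_if (B l e) (Cell (F l e) a) a)"
proof -
  obtain p where p: "\<And>w. size_sexp (F (car w) (cdr w)) \<le> poly p (size_sexp w)"
    using assms[THEN ptime_size] by blast
  have "size_sexp (s_if (B l e) (Cell (F l e) a) a)
      \<le> size_sexp a + poly (1 + p \<circ>\<^sub>p [:1, 1:]) (size_sexp l + size_sexp e)" for l a e
    using p[of "Cell l e"] by (simp add: s_if_def poly_pcompose)
  thus ?thesis unfolding additive_def by blast
qed

section \<open>The reduction on codes\<close>

definition s_eq :: "sexp \<Rightarrow> sexp \<Rightarrow> sexp" where
  "s_eq x y = s_times (s_le x y) (s_le y x)"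

text \<open>Cross-multiplication, which is sound on codes because \<open>quotient_of\<close> yields
  positive denominators.\<close>

definition s_rat_le :: "sexp \<Rightarrow> sexp \<Rightarrow> sexp" where
  "s_rat_le x y = s_le (s_times (car x) (cdr y)) (s_times (car y) (cdr x))"

definition s_contains :: "sexp \<Rightarrow> sexp \<Rightarrow> sexp" where
  "s_contains I x = s_times (s_rat_le (car I) x) (s_rat_le x (cdr I))"

text \<open>The sum is 2 if both endpoints lie in \<open>I\<close>; this is harmless, as
  \<open>s_if\<close> only distinguishes zero from nonzero.\<close>

definition s_covers :: "sexp \<Rightarrow> sexp \<Rightarrow> sexp" where
  "s_covers I C = s_plus (s_contains I (car C)) (s_contains I (cdr C))"

definition s_length :: "sexp \<Rightarrow> sexp" where
  "s_length l = s_fold (\<lambda>l a e. s_plus a (Atom 1)) l (Atom 0) (Atom 0)"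

definition s_mem :: "sexp \<Rightarrow> sexp \<Rightarrow> sexp" where
  "s_mem x l = s_fold (\<lambda>l a e. s_if (s_eq (car l) e) (Atom 1) a) l (Atom 0) x"

text \<open>An interval is represented by the number of intervals from its position to the end of the
  list, plus 1; the numbers 0 and 1 are left for the two terminals.\<close>

definition s_vertex :: "sexp \<Rightarrow> sexp" where
  "s_vertex l = s_plus (s_length l) (Atom 1)"

text \<open>The constantly true test gives the step the shape that \<open>additive_push\<close>
  expects.\<close>

definition s_vertices :: "sexp \<Rightarrow> sexp" where
  "s_vertices Is = Cell (Atom 0) (Cell (Atom 1)
    (s_fold (\<lambda>l a e. s_if (Atom 1) (Cell (s_vertex l) a) a) Is (Atom 0) (Atom 0)))"

definition s_path :: "sexp \<Rightarrow> sexp \<Rightarrow> sexp" where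
  "s_path Is C = Cell (Atom 0)
    (s_fold (\<lambda>l a e. s_if (s_covers (car l) e) (Cell (s_vertex l) a) a) Is
      (Cell (Atom 1) (Atom 0)) C)"

text \<open>The edges collected so far are the initial accumulator, so the edge lists of successive
  segments are joined without an append operation.\<close>

definition s_hops :: "sexp \<Rightarrow> sexp \<Rightarrow> sexp \<Rightarrow> sexp" where
  "s_hops p a j = s_fold (\<lambda>l a j. s_if (truth (is_cell (cdr l)))
      (Cell (Cell (car l) (Cell (car (cdr l)) j)) (Cell (Cell (car (cdr l)) (Cell (car l) j)) a)) a)
    p a j"

text \<open>The label of a snapshot is the number of segments from the current one to the end of the
  list, so labels run downwards to 1.\<close>

definition s_edges :: "sexp \<Rightarrow> sexp \<Rightarrow> sexp" where
  "s_edges Cs Is = s_fold (\<lambda>l a e. s_hops (s_path e (car l)) a (s_length l)) Cs (Atom 0) Is"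

definition s_reduce :: "sexp \<Rightarrow> sexp" where
  "s_reduce v = Cell (s_vertices (cdr v)) (Cell (s_edges (car v) (cdr v))
    (Cell (s_length (car v)) (Cell (Atom 0) (Cell (Atom 1) (Atom 1)))))"

text \<open>The vertex number of each interval is recomputed from its position, so the separator is
  translated back without an inverse table.\<close>

definition s_back :: "sexp \<Rightarrow> sexp" where
  "s_back u = s_fold (\<lambda>l a w. s_if (s_mem (s_vertex l) w) (Cell (car l) a) a)
    (cdr (car u)) (Atom 0) (cdr u)"

section \<open>Polynomial time of the reduction and of the back map\<close>

lemma ptime_s_eq: "ptime f \<Longrightarrow> ptime g \<Longrightarrow> ptime (\<lambda>v. s_eq (f v) (g v))"
  unfolding s_eq_def by (intro ptime_intros)

lemma ptime_s_covers: "ptime f \<Longrightarrow> ptime g \<Longrightarrow> ptime (\<lambda>v. s_covers (f v) (g v))"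
  unfolding s_covers_def s_contains_def s_rat_le_def by (intro ptime_intros)

lemma ptime_s_length: "ptime f \<Longrightarrow> ptime (\<lambda>v. s_length (f v))"
  unfolding s_length_def
proof (intro ptime_s_fold ptime_intros)
  have "size_sexp (s_plus a (Atom 1)) \<le> size_sexp a + poly 2 k" for a k
    using size_s_plus_le[of a "Atom 1"] by simp
  thus "additive (\<lambda>l a e. s_plus a (Atom 1))"
    unfolding additive_def by blast
qed

lemma ptime_s_mem: "ptime f \<Longrightarrow> ptime g \<Longrightarrow> ptime (\<lambda>v. s_mem (f v) (g v))"
  unfolding s_mem_def
proof (intro ptime_s_fold ptime_intros ptime_s_eq)
  have "size_sexp (s_if b (Atom 1) a) \<le> size_sexp a + poly 2 k" for a b k
    by (simp add: s_if_def)
  thus "additive (\<lambda>l a e. s_if (s_eq (car l) e) (Atom 1) a)"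
    unfolding additive_def by blast
qed

lemma ptime_s_vertex: "ptime f \<Longrightarrow> ptime (\<lambda>v. s_vertex (f v))"
  unfolding s_vertex_def by (intro ptime_intros ptime_s_length)

lemma ptime_s_vertices: "ptime f \<Longrightarrow> ptime (\<lambda>v. s_vertices (f v))"
  unfolding s_vertices_def by (intro ptime_s_fold ptime_intros ptime_s_vertex additive_push)

lemma ptime_s_path: "ptime f \<Longrightarrow> ptime g \<Longrightarrow> ptime (\<lambda>v. s_path (f v) (g v))"
  unfolding s_path_def
  by (intro ptime_s_fold ptime_intros ptime_s_vertex ptime_s_covers additive_push)

lemma additive_s_hops_step:
  "additive (\<lambda>l a j. s_if (truth (is_cell (cdr l)))
    (Cell (Cell (car l) (Cell (car (cdr l)) j)) (Cell (Cell (car (cdr l)) (Cell (car l) j)) a)) a)"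
  by (intro additive_push2 ptime_intros)

lemma ptime_s_hops:
  "ptime f \<Longrightarrow> ptime g \<Longrightarrow> ptime h \<Longrightarrow> ptime (\<lambda>v. s_hops (f v) (g v) (h v))"
  unfolding s_hops_def by (intro ptime_s_fold ptime_intros additive_s_hops_step)

text \<open>A whole inner fold is an admissible step of an outer fold: by
  \<open>size_s_fold_le\<close> its total growth depends on the path and the label only, and these
  do not depend on the accumulator.\<close>

lemma additive_s_hops:
  assumes "ptime (\<lambda>w. P (car w) (cdr w))" "ptime (\<lambda>w. J (car w) (cdr w))"
  shows "additive (\<lambda>l a e. s_hops (P l e) a (J l e))"
proof -
  obtain q where q: "\<And>p a j. size_sexp (s_hops p a j)
      \<le> size_sexp a + size_sexp p * poly q (size_sexp p + size_sexp j)"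
    using additive_s_hops_step size_s_fold_le[OF _ order_refl]
    unfolding s_hops_def additive_def by meson
  have "ptime (\<lambda>w. Cell (P (car w) (cdr w)) (J (car w) (cdr w)))"
    by (intro ptime_intros assms)
  then obtain r where r: "\<And>w. size_sexp (Cell (P (car w) (cdr w)) (J (car w) (cdr w)))
      \<le> poly r (size_sexp w)"
    using ptime_size by blast
  have "size_sexp (s_hops (P l e) a (J l e))
      \<le> size_sexp a + poly ((r * q \<circ>\<^sub>p r) \<circ>\<^sub>p [:1, 1:]) (size_sexp l + size_sexp e)" for l a e
  proof -
    let ?r = "poly r (size_sexp (Cell l e))"
    have "Suc (size_sexp (P l e) + size_sexp (J l e)) \<le> ?r"
      using r[of "Cell l e"] by simp
    hence "size_sexp (P l e) * poly q (size_sexp (P l e) + size_sexp (J l e)) \<le> ?r * poly q ?r"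
      by (intro mult_mono poly_nat_mono) auto
    thus ?thesis
      using q[of "P l e" a "J l e"] by (simp add: poly_pcompose)
  qed
  thus ?thesis unfolding additive_def by blast
qed

lemma ptime_s_reduce: "ptime f \<Longrightarrow> ptime (\<lambda>v. s_reduce (f v))"
  unfolding s_reduce_def s_edges_def
  by (intro ptime_intros ptime_s_vertices ptime_s_fold ptime_s_length ptime_s_path ptime_s_hops
      additive_s_hops)

lemma ptime_s_back: "ptime f \<Longrightarrow> ptime (\<lambda>v. s_back (f v))"
  unfolding s_back_def
  by (intro ptime_s_fold ptime_s_mem ptime_s_vertex additive_push ptime_intros)

section \<open>Values of the code functions on valid codes\<close>

lemma code_list_simps [simp]:
  "code_list code [] = Atom 0" "code_list code (x # xs) = Cell (code x) (code_list code xs)"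
  by (simp_all add: code_list_def)

lemma s_rat_le_code: "s_rat_le (code_rat r) (code_rat s) = truth (r \<le> s)"
  by (simp add: s_rat_le_def s_times_def s_le_def code_rat_def rat_less_eq_code Let_def
      split_beta mult.commute)

lemma s_if_covers:
  "s_if (s_covers (code_interval I) (code_interval C)) x y = (if covers I C then x else y)"
  by (auto simp: s_if_def s_covers_def s_contains_def s_plus_def s_times_def code_interval_def
      s_rat_le_code covers_def)

lemma s_length_code: "s_length (code_list code xs) = Atom (int (length xs))"
proof -
  have "s_fold (\<lambda>l a e. s_plus a (Atom 1)) (code_list code xs) (Atom k) e = Atom (k + int (length xs))"
    for k e
    by (induction xs arbitrary: k) (auto simp: s_plus_def)
  thus ?thesis by (simp add: s_length_def)
qed

lemma s_mem_code: "s_if (s_mem (code_nat n) (code_list code_nat ns)) x y = (if n \<in> set ns then x else y)"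
proof -
  have "s_fold (\<lambda>l a e. s_if (s_eq (car l) e) (Atom 1) a) (code_list code_nat ns) a (code_nat n) =
      (if n \<in> set ns then Atom 1 else a)" for a
    by (induction ns arbitrary: a)
      (auto simp: s_if_def s_eq_def s_times_def s_le_def code_nat_def)
  thus ?thesis by (simp add: s_mem_def s_if_def)
qed

lemma s_vertex_code: "s_vertex (Cell (code x) (code_list code xs)) = code_nat (length xs + 2)"
  using s_length_code[of code "x # xs"] by (simp add: s_vertex_def s_plus_def code_nat_def)

text \<open>Counting from the end makes the number of an element depend only on the list behind it,
  which is what a fold step sees. The offset is 2 for intervals, after the two terminals, and 1 for
  segments, since labels start at 1.\<close>

fun numbered :: "nat \<Rightarrow> 'a list \<Rightarrow> (nat \<times> 'a) list" where
  "numbered k [] = []"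
| "numbered k (x # xs) = (length xs + k, x) # numbered k xs"

lemma map_snd_numbered [simp]: "map snd (numbered k xs) = xs"
  by (induction xs) auto

lemma set_fst_numbered: "fst ` set (numbered k xs) = {k..<k + length xs}"
  by (induction xs) auto

lemma distinct_fst_numbered: "distinct (map fst (numbered k xs))"
  by (induction xs) (auto simp: set_fst_numbered)

lemma snd_numbered: "snd ` set (numbered k xs) = set xs"
  by (metis map_snd_numbered set_map)

definition path_of :: "interval list \<Rightarrow> interval \<Rightarrow> nat list" where
  "path_of Is C = 0 # rev (map fst (filter (\<lambda>(i, I). covers I C) (numbered 2 Is))) @ [1]"

text \<open>Edges are pushed in the same order as by \<open>s_hops\<close>, so that the two agree as
  lists and not merely as sets.\<close>

fun push_hops :: "nat \<Rightarrow> nat list \<Rightarrow> nat tedge list \<Rightarrow> nat tedge list" where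
  "push_hops j (u # w # p) a = push_hops j (w # p) ((u, w, j) # (w, u, j) # a)"
| "push_hops j _ a = a"

fun push_paths :: "interval list \<Rightarrow> interval list \<Rightarrow> nat tedge list \<Rightarrow> nat tedge list" where
  "push_paths Is [] a = a"
| "push_paths Is (C # Cs) a = push_paths Is Cs (push_hops (length Cs + 1) (path_of Is C) a)"

lemma s_vertices_code:
  "s_vertices (code_list code xs) = code_list code_nat (0 # 1 # rev (map fst (numbered 2 xs)))"
proof -
  have "s_fold (\<lambda>l a e. s_if (Atom 1) (Cell (s_vertex l) a) a) (code_list code xs)
      (code_list code_nat a) e = code_list code_nat (rev (map fst (numbered 2 xs)) @ a)" for a e
  proof (induction xs arbitrary: a)
    case (Cons x xs)
    show ?case using Cons[of "(length xs + 2) # a"] by (simp add: s_vertex_code s_if_def)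
  qed simp
  from this[of "[]"] show ?thesis by (simp add: s_vertices_def code_nat_def)
qed

lemma s_path_code:
  "s_path (code_list code_interval Is) (code_interval C) = code_list code_nat (path_of Is C)"
proof -
  have "s_fold (\<lambda>l a e. s_if (s_covers (car l) e) (Cell (s_vertex l) a) a)
      (code_list code_interval Is) (code_list code_nat a) (code_interval C) =
      code_list code_nat (rev (map fst (filter (\<lambda>(i, I). covers I C) (numbered 2 Is))) @ a)" for a
  proof (induction Is arbitrary: a)
    case (Cons x xs)
    show ?case using Cons[of "(length xs + 2) # a"] Cons[of a] by (simp add: s_vertex_code s_if_covers)
  qed simp
  from this[of "[1]"] show ?thesis by (simp add: s_path_def path_of_def code_nat_def)
qed

lemma s_hops_code:
  "s_hops (code_list code_nat p) (code_list code_tedge a) (code_nat j) =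
    code_list code_tedge (push_hops j p a)"
proof (induction j p a rule: push_hops.induct)
  case (1 j u w p a)
  thus ?case by (simp add: s_hops_def s_if_def code_tedge_def tail_def head_def label_def)
qed (simp_all add: s_hops_def s_if_def)

lemma s_edges_code:
  "s_edges (code_list code_interval Cs) (code_list code_interval Is) =
    code_list code_tedge (push_paths Is Cs [])"
proof -
  have "s_fold (\<lambda>l a e. s_hops (s_path e (car l)) a (s_length l)) (code_list code_interval Cs)
      (code_list code_tedge a) (code_list code_interval Is) =
      code_list code_tedge (push_paths Is Cs a)" for a
  proof (induction Cs arbitrary: a)
    case (Cons C Cs)
    have "s_length (Cell (code_interval C) (code_list code_interval Cs)) = code_nat (length Cs + 1)"
      using s_length_code[of code_interval "C # Cs"] by (simp add: code_nat_def)
    thus ?case by (simp add: s_path_code s_hops_code Cons.IH)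
  qed simp
  from this[of "[]"] show ?thesis by (simp add: s_edges_def)
qed

lemma s_back_code:
  "s_back (Cell (Cell v (code_list code xs)) (code_list code_nat ns)) =
    code_list code (rev (map snd (filter (\<lambda>(i, x). i \<in> set ns) (numbered 2 xs))))"
proof -
  have "s_fold (\<lambda>l a w. s_if (s_mem (s_vertex l) w) (Cell (car l) a) a) (code_list code xs)
      (code_list code a) (code_list code_nat ns) =
      code_list code (rev (map snd (filter (\<lambda>(i, x). i \<in> set ns) (numbered 2 xs))) @ a)" for a
  proof (induction xs arbitrary: a)
    case (Cons x xs)
    show ?case using Cons[of "x # a"] Cons[of a] by (simp add: s_vertex_code s_mem_code)
  qed simp
  from this[of "[]"] show ?thesis by (simp add: s_back_def)
qed

section \<open>The temporal graph of a covering instance\<close>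

definition adjacent :: "'a list \<Rightarrow> 'a \<Rightarrow> 'a \<Rightarrow> bool" where
  "adjacent p u w \<longleftrightarrow> (u, w) \<in> set (zip p (tl p)) \<or> (w, u) \<in> set (zip p (tl p))"

lemma adjacent_Cons2:
  "adjacent (u # w # p) x y \<longleftrightarrow> (x, y) = (u, w) \<or> (x, y) = (w, u) \<or> adjacent (w # p) x y"
  by (auto simp: adjacent_def)

lemma adjacent_sym: "adjacent p u w \<longleftrightarrow> adjacent p w u"
  by (auto simp: adjacent_def)

lemma adjacent_in_set: "adjacent p u w \<Longrightarrow> u \<in> set p \<and> w \<in> set p"
  by (cases p) (auto simp: adjacent_def dest: set_zip_leftD set_zip_rightD)

lemma adjacent_irrefl: "distinct p \<Longrightarrow> \<not> adjacent p u u"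
  by (induction p rule: induct_list012) (auto simp: adjacent_Cons2, auto simp: adjacent_def)

lemma set_push_hops: "set (push_hops j p a) = set a \<union> {(u, w, j) | u w. adjacent p u w}"
  by (induction j p a rule: push_hops.induct) (auto simp: adjacent_Cons2, auto simp: adjacent_def)

text \<open>The disjunction in the last premise survives the recursion: the two new edges contain
  \<open>u\<close>, which by distinctness does not occur in the rest of the path.\<close>

lemma distinct_push_hops:
  assumes "distinct p" "distinct a"
    and "\<And>u w. (u, w, j) \<in> set a \<Longrightarrow> u \<notin> set p \<or> w \<notin> set p"
  shows "distinct (push_hops j p a)"
  using assms
proof (induction j p a rule: push_hops.induct)
  case (1 j u w p a)
  show ?case
    unfolding push_hops.simps
  proof (rule "1.IH")
    show "distinct ((u, w, j) # (w, u, j) # a)"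
      using "1.prems"(1,2) "1.prems"(3)[of u w] "1.prems"(3)[of w u] by auto
  qed (use "1.prems" in fastforce)+
qed auto

lemma set_push_paths:
  "set (push_paths Is Cs a) =
    set a \<union> {(u, w, j) | u w j C. (j, C) \<in> set (numbered 1 Cs) \<and> adjacent (path_of Is C) u w}"
  by (induction Cs arbitrary: a) (auto simp: set_push_hops simp del: split_paired_Ex)

lemma set_path_of: "set (path_of Is C) = {0, 1} \<union> {i. \<exists>I. (i, I) \<in> set (numbered 2 Is) \<and> covers I C}"
  by (force simp: path_of_def)

lemma path_of_subset: "set (path_of Is C) \<subseteq> {..<length Is + 2}"
  using set_fst_numbered[of 2 Is] by (force simp: set_path_of)

lemma distinct_path_of: "distinct (path_of Is C)"
proof -
  have "distinct (map fst (filter (\<lambda>(i, I). covers I C) (numbered 2 Is)))"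
    using distinct_fst_numbered by (rule distinct_map_filter)
  moreover have "2 \<le> i" if "(i, I) \<in> set (numbered 2 Is)" for i I
    using that set_fst_numbered[of 2 Is] by force
  ultimately show ?thesis by (force simp: path_of_def)
qed

text \<open>Labels strictly decrease from segment to segment, so an edge can only be repeated within
  one snapshot, where \<open>distinct_push_hops\<close> applies.\<close>

lemma distinct_push_paths:
  assumes "distinct a" "\<And>e. e \<in> set a \<Longrightarrow> length Cs < label e"
  shows "distinct (push_paths Is Cs a)"
  using assms
proof (induction Cs arbitrary: a)
  case (Cons C Cs)
  show ?case
    unfolding push_paths.simps
    by (rule Cons.IH)
      (use Cons.prems in \<open>fastforce simp: set_push_hops label_def
        intro!: distinct_push_hops distinct_path_of\<close>)+
qed simp

definition cover_graph :: "interval list \<Rightarrow> interval list \<Rightarrow> nat tgraph" where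
  "cover_graph Cs Is =
    \<lparr> verts = {..<length Is + 2}, tedges = set (push_paths Is Cs []), lifetime = length Cs \<rparr>"

lemma tedges_cover_graph:
  "(u, w, j) \<in> tedges (cover_graph Cs Is) \<longleftrightarrow>
    (\<exists>C. (j, C) \<in> set (numbered 1 Cs) \<and> adjacent (path_of Is C) u w)"
  by (auto simp: cover_graph_def set_push_paths)

lemma temporal_graph_cover_graph: "temporal_graph (cover_graph Cs Is)"
  unfolding temporal_graph_def
proof (intro conjI allI)
  show "tedges (cover_graph Cs Is) \<subseteq>
      verts (cover_graph Cs Is) \<times> verts (cover_graph Cs Is) \<times> {1..lifetime (cover_graph Cs Is)}"
  proof
    fix e assume "e \<in> tedges (cover_graph Cs Is)"
    then obtain u w j C where e: "e = (u, w, j)" and C: "(j, C) \<in> set (numbered 1 Cs)" "adjacent (path_of Is C) u w"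
      by (cases e) (auto simp: tedges_cover_graph)
    have "u \<in> verts (cover_graph Cs Is)" "w \<in> verts (cover_graph Cs Is)"
      using adjacent_in_set[OF C(2)] path_of_subset[of Is C] by (auto simp: cover_graph_def)
    moreover have "j \<in> fst ` set (numbered 1 Cs)"
      using C(1) by (rule image_eqI[rotated]) simp
    hence "j \<in> {1..lifetime (cover_graph Cs Is)}"
      by (simp add: set_fst_numbered cover_graph_def)
    ultimately show "e \<in> verts (cover_graph Cs Is) \<times> verts (cover_graph Cs Is) \<times>
        {1..lifetime (cover_graph Cs Is)}"
      by (simp add: e)
  qed
  show "(u, w, j) \<in> tedges (cover_graph Cs Is) \<longleftrightarrow> (w, u, j) \<in> tedges (cover_graph Cs Is)" for u w j
    unfolding tedges_cover_graph using adjacent_sym by metis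
  show "(u, u, j) \<notin> tedges (cover_graph Cs Is)" for u j
    unfolding tedges_cover_graph using adjacent_irrefl[OF distinct_path_of] by metis
qed (simp add: cover_graph_def)

section \<open>Separators of a snapshot are hitting sets of its path\<close>

lemma path_along_list:
  assumes "distinct p" "2 \<le> length p" "\<And>u w. adjacent p u w \<Longrightarrow> (u, w, j) \<in> tedges G"
  shows "\<exists>es. deadline_path G (hd p) (last p) 1 es \<and> path_verts es \<subseteq> set p"
proof -
  define es where "es = map (\<lambda>(u, w). (u, w, j)) (zip p (tl p))"
  have len: "length es = length p - 1" by (simp add: es_def)
  have nth: "es ! i = (p ! i, p ! Suc i, j)" if "i < length es" for i
    using that by (simp add: es_def nth_tl)
  have ne: "es \<noteq> []" using len assms(2) by auto
  have heads: "map head es = tl p"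
    by (rule nth_equalityI) (auto simp: len nth head_def nth_tl)
  have "label e = j" if "e \<in> set es" for e
    using that by (auto simp: es_def label_def)
  hence labels: "map label es = replicate (length es) j"
    by (intro map_replicate_const[THEN trans[rotated]] map_cong) auto
  have p: "p \<noteq> []" "tl p \<noteq> []"
    using assms(2) by (cases p; force)+
  have "temporal_path G (hd p) (last p) es"
    unfolding temporal_path_def
  proof (intro conjI allI impI)
    show "set es \<subseteq> tedges G"
      using assms(3) by (auto simp: es_def adjacent_def)
    show "tail (hd es) = hd p"
      using ne nth[of 0] p by (simp add: hd_conv_nth tail_def)
    show "head (last es) = last p"
      using heads ne p last_map[of es head] by (simp add: last_tl)
    show "head (es ! i) = tail (es ! Suc i)" if "Suc i < length es" for i
      using that nth[of i] nth[of "Suc i"] by (simp add: head_def tail_def)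
    show "distinct (hd p # map head es)"
      using assms(1) p by (simp add: heads)
    show "sorted (map label es)"
      by (simp add: labels)
  qed (rule ne)
  moreover have "label (hd es) = j" "label (last es) = j"
    using ne by (auto simp: es_def label_def hd_map last_map split_beta)
  hence "travelling_time es \<le> 1"
    by (simp add: travelling_time_def)
  moreover have "u \<in> set p \<and> w \<in> set p" if "(u, w) \<in> set (zip p (tl p))" for u w
    using that adjacent_in_set[of p u w] by (simp add: adjacent_def)
  hence "path_verts es \<subseteq> set p"
    by (auto simp: path_verts_def es_def tail_def head_def)
  ultimately show ?thesis
    unfolding deadline_path_def by blast
qed

lemma adjacent_prefix:
  assumes "distinct (ps @ x # qs)" "adjacent (ps @ x # qs) u w" "u \<in> set ps" "w \<noteq> x"
  shows "w \<in> set ps"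
proof -
  let ?p = "ps @ x # qs"
  obtain k where k: "k < length ps" "u = ?p ! k"
    using assms(3) by (auto simp: in_set_conv_nth nth_append)
  have "\<exists>i. Suc i < length ?p \<and> ((u, w) = (?p ! i, ?p ! Suc i) \<or> (w, u) = (?p ! i, ?p ! Suc i))"
    using assms(2) by (fastforce simp: adjacent_def set_zip nth_tl)
  then obtain i where i: "Suc i < length ?p" "u = ?p ! i \<and> w = ?p ! Suc i \<or> w = ?p ! i \<and> u = ?p ! Suc i"
    by auto
  hence "i = k \<and> w = ?p ! Suc i \<or> Suc i = k \<and> w = ?p ! i"
    using k assms(1) by (auto simp: nth_eq_iff_index_eq)
  \<comment> \<open>A neighbour of position \<open>k < length ps\<close> has position at most
    \<open>length ps\<close>, and position \<open>length ps\<close> is occupied by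
    \<open>x\<close>.\<close>
  then obtain m where m: "m \<le> length ps" "w = ?p ! m"
    using k(1) by (metis Suc_leI Suc_lessD less_imp_le)
  moreover have "m \<noteq> length ps"
    using m assms(4) by auto
  ultimately show ?thesis
    by (simp add: nth_append)
qed

text \<open>A discrete intermediate value argument: a walk along a path cannot jump over a vertex.\<close>

lemma walk_visits:
  assumes p: "distinct (ps @ x # qs)"
    and walk: "\<And>e. e \<in> set es \<Longrightarrow> adjacent (ps @ x # qs) (tail e) (head e)"
    and chain: "\<And>i. Suc i < length es \<Longrightarrow> head (es ! i) = tail (es ! Suc i)"
    and ends: "es \<noteq> []" "tail (hd es) \<in> set ps" "head (last es) \<notin> set ps"
  shows "x \<in> path_verts es"
proof (rule ccontr)
  assume x: "x \<notin> path_verts es"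
  have step: "head (es ! i) \<in> set ps" if "i < length es" "tail (es ! i) \<in> set ps" for i
  proof (rule adjacent_prefix[OF p walk])
    show "head (es ! i) \<noteq> x"
      using x that(1) by (auto simp: path_verts_def)
  qed (use that in auto)
  have "head (es ! i) \<in> set ps" if "i < length es" for i
    using that
  proof (induction i)
    case 0
    thus ?case using step[of 0] ends by (simp add: hd_conv_nth)
  next
    case (Suc i)
    thus ?case using step[of "Suc i"] chain[of i] by simp
  qed
  from this[of "length es - 1"] show False
    using ends by (simp add: last_conv_nth)
qed

lemma separator_cover_graph:
  "separator (cover_graph Cs Is) 0 1 1 S \<longleftrightarrow>
    S \<subseteq> fst ` set (numbered 2 Is) \<and>
    (\<forall>C\<in>set Cs. \<exists>i I. (i, I) \<in> set (numbered 2 Is) \<and> i \<in> S \<and> covers I C)"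
proof -
  let ?G = "cover_graph Cs Is"
  have verts: "verts ?G - {0, 1} = fst ` set (numbered 2 Is)"
    by (auto simp: set_fst_numbered cover_graph_def)
  have "(\<forall>es. deadline_path ?G 0 1 1 es \<longrightarrow> S \<inter> path_verts es \<noteq> {}) \<longleftrightarrow>
      (\<forall>C\<in>set Cs. \<exists>i I. (i, I) \<in> set (numbered 2 Is) \<and> i \<in> S \<and> covers I C)"
    (is "?sep \<longleftrightarrow> ?hit") if S: "S \<subseteq> verts ?G - {0, 1}"
  proof
    assume ?sep
    show ?hit
    proof
      fix C assume "C \<in> set Cs"
      then obtain j where j: "(j, C) \<in> set (numbered 1 Cs)"
        using snd_numbered[of 1 Cs] by (metis imageE prod.collapse)
      have "hd (path_of Is C) = 0" "last (path_of Is C) = 1" "2 \<le> length (path_of Is C)"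
        by (auto simp: path_of_def)
      moreover have "(u, w, j) \<in> tedges ?G" if "adjacent (path_of Is C) u w" for u w
        using j that unfolding tedges_cover_graph by blast
      ultimately obtain es
        where "deadline_path ?G 0 1 1 es" "path_verts es \<subseteq> set (path_of Is C)"
        using path_along_list[OF distinct_path_of] by metis
      \<comment> \<open>As \<open>S\<close> contains neither terminal, the vertex where it meets the
        path is the number of an interval covering \<open>C\<close>.\<close>
      with \<open>?sep\<close> S show "\<exists>i I. (i, I) \<in> set (numbered 2 Is) \<and> i \<in> S \<and> covers I C"
        unfolding set_path_of by blast
    qed
  next
    assume ?hit
    show ?sep
    proof (intro allI impI)
      fix es assume "deadline_path ?G 0 1 1 es"
      hence ne: "es \<noteq> []" and edges: "set es \<subseteq> tedges ?G"
        and ends: "tail (hd es) = 0" "head (last es) = 1"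
        and chain: "\<And>i. Suc i < length es \<Longrightarrow> head (es ! i) = tail (es ! Suc i)"
        and sorted: "sorted (map label es)" and time: "label (last es) - label (hd es) + 1 \<le> 1"
        by (auto simp: deadline_path_def temporal_path_def travelling_time_def)
      let ?j = "label (hd es)"
      \<comment> \<open>The deadline 1 forces the last label to be at most the first; since labels
        are sorted, they are all equal.\<close>
      have label: "label e = ?j" if "e \<in> set es" for e
      proof -
        obtain i where i: "i < length es" "e = es ! i"
          using \<open>e \<in> set es\<close> by (auto simp: in_set_conv_nth)
        have "label (es ! 0) \<le> label (es ! i)" "label (es ! i) \<le> label (es ! (length es - 1))"
          using sorted_nth_mono[OF sorted, of 0 i] sorted_nth_mono[OF sorted, of i "length es - 1"]
            i(1) ne nth_map[of 0 es label] by auto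
        thus ?thesis
          using time ne i(2) by (simp add: hd_conv_nth last_conv_nth)
      qed
      have step: "\<exists>C. (?j, C) \<in> set (numbered 1 Cs) \<and> adjacent (path_of Is C) (tail e) (head e)"
        if "e \<in> set es" for e
      proof -
        have "(tail e, head e, label e) \<in> tedges ?G"
          using edges that by (auto simp: tail_def head_def label_def)
        thus ?thesis
          unfolding label[OF that] tedges_cover_graph .
      qed
      obtain C where C: "(?j, C) \<in> set (numbered 1 Cs)"
        using step[of "hd es"] ne by auto
      have walk: "adjacent (path_of Is C) (tail e) (head e)" if "e \<in> set es" for e
        \<comment> \<open>A label belongs to one segment only, so the segments found for the
          individual edges coincide.\<close>
        using step[OF that] C distinct_fst_numbered[of 1 Cs] by (auto dest: eq_key_imp_eq_value)
      obtain x I where x: "(x, I) \<in> set (numbered 2 Is)" "x \<in> S" "covers I C"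
        using \<open>?hit\<close> C snd_numbered[of 1 Cs] by force
      obtain ps qs where split: "path_of Is C = ps @ x # qs"
        using x by (metis (mono_tags, lifting) UnI2 mem_Collect_eq set_path_of split_list)
      have "x \<noteq> 0" "x \<noteq> 1"
        using S x(2) by auto
      \<comment> \<open>An inner vertex of the path has the two terminals on opposite sides, so the
        walk starts before \<open>x\<close> and ends beyond it.\<close>
      hence "0 \<in> set ps" "1 \<in> set qs"
        using arg_cong[OF split, of hd] arg_cong[OF split, of last]
        by (cases ps; cases qs rule: rev_cases; auto simp: path_of_def)+
      moreover have "distinct (ps @ x # qs)"
        using distinct_path_of[of Is C] by (simp add: split)
      ultimately have "x \<in> path_verts es"
        by (intro walk_visits[of ps x qs es]) (use walk chain ne ends in \<open>auto simp: split\<close>)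
      thus "S \<inter> path_verts es \<noteq> {}"
        using x(2) by blast
    qed
  qed
  thus ?thesis
    unfolding separator_def verts by blast
qed

section \<open>The reduction\<close>

lemma reduction_disc_sc: "reduction disc_sc temporal_separator s_reduce s_back"
  unfolding reduction_def
proof (intro ballI allI impI)
  fix x v assume "inst_code disc_sc x v"
  moreover obtain \<Gamma> \<I> where x: "x = (\<Gamma>, \<I>)"
    by (cases x)
  ultimately have v: "inst_code disc_sc (\<Gamma>, \<I>) v"
    by simp
  obtain Cs Is where Cs: "distinct Cs" "set Cs = \<Gamma>" and Is: "distinct Is" "set Is = \<I>"
    and v_eq: "v = Cell (code_list code_interval Cs) (code_list code_interval Is)"
    using v by (auto simp: disc_sc_def codes_set_def)
  let ?N = "set (numbered 2 Is)"
  define y :: "nat tgraph \<times> nat \<times> nat \<times> nat" where "y = (cover_graph Cs Is, 0, 1, 1)"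
  \<comment> \<open>\<open>pick\<close> and \<open>ids\<close> translate solutions along the graph
    \<open>?N\<close> of the numbering. Both projections are injective on it, \<open>fst\<close> by
    the numbering and \<open>snd\<close> because \<open>Is\<close> has no duplicates, so
    cardinalities are preserved in both directions.\<close>
  define pick where "pick S = snd ` {x\<in>?N. fst x \<in> S}" for S
  define ids where "ids A = fst ` {x\<in>?N. snd x \<in> A}" for A
  have inj: "inj_on fst ?N" "inj_on snd ?N"
    using distinct_fst_numbered[of 2 Is] map_snd_numbered[of 2 Is] Is(1)
    by (metis distinct_map)+
  have sols_y: "S \<in> sols temporal_separator y \<longleftrightarrow> S \<subseteq> fst ` ?N \<and>
      (\<forall>C\<in>\<Gamma>. \<exists>i I. (i, I) \<in> ?N \<and> i \<in> S \<and> covers I C)" for S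
    by (simp add: temporal_separator_def y_def separator_cover_graph Cs flip: One_nat_def)
  have sols_x: "A \<in> sols disc_sc (\<Gamma>, \<I>) \<longleftrightarrow> A \<subseteq> snd ` ?N \<and> (\<forall>C\<in>\<Gamma>. \<exists>I\<in>A. covers I C)" for A
    by (simp add: disc_sc_def disc_sc_cover_def snd_numbered Is)
  have pick: "pick S \<in> sols disc_sc (\<Gamma>, \<I>)" "card (pick S) = card S"
    if "S \<in> sols temporal_separator y" for S
  proof -
    show "pick S \<in> sols disc_sc (\<Gamma>, \<I>)"
      using that unfolding sols_x sols_y pick_def by force
    have "S = fst ` {x\<in>?N. fst x \<in> S}"
      using that unfolding sols_y by auto
    moreover have "card (pick S) = card {x\<in>?N. fst x \<in> S}"
      unfolding pick_def by (intro card_image inj_on_subset[OF inj(2)]) auto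
    moreover have "card (fst ` {x\<in>?N. fst x \<in> S}) = card {x\<in>?N. fst x \<in> S}"
      by (intro card_image inj_on_subset[OF inj(1)]) auto
    ultimately show "card (pick S) = card S" by simp
  qed
  have ids: "ids A \<in> sols temporal_separator y" "card (ids A) = card A"
    if "A \<in> sols disc_sc (\<Gamma>, \<I>)" for A
  proof -
    show "ids A \<in> sols temporal_separator y"
      using that unfolding sols_x sols_y ids_def by (force simp: image_iff)
    have "A = snd ` {x\<in>?N. snd x \<in> A}"
      using that unfolding sols_x by blast
    moreover have "card (ids A) = card {x\<in>?N. snd x \<in> A}"
      unfolding ids_def by (intro card_image inj_on_subset[OF inj(1)]) auto
    moreover have "card (snd ` {x\<in>?N. snd x \<in> A}) = card {x\<in>?N. snd x \<in> A}"
      by (intro card_image inj_on_subset[OF inj(2)]) auto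
    ultimately show "card (ids A) = card A" by simp
  qed
  have costs: "cost disc_sc = card" "cost temporal_separator = card"
    by (simp_all add: disc_sc_def temporal_separator_def)
  show "\<exists>y\<in>insts temporal_separator. inst_code temporal_separator y (s_reduce v) \<and>
      (\<forall>k. (\<exists>A\<in>sols disc_sc x. cost disc_sc A \<le> k) \<longleftrightarrow>
        (\<exists>S\<in>sols temporal_separator y. cost temporal_separator S \<le> k)) \<and>
      (\<forall>S\<in>sols temporal_separator y. \<forall>w. sol_code temporal_separator S w \<longrightarrow>
        (\<exists>A\<in>sols disc_sc x. sol_code disc_sc A (s_back (Cell v w)) \<and>
          (optimal temporal_separator y S \<longrightarrow> optimal disc_sc x A)))"
    unfolding x
  proof (intro bexI[of _ y] conjI allI impI ballI)
    show "y \<in> insts temporal_separator"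
      using temporal_graph_cover_graph
      by (simp add: temporal_separator_def y_def) (simp add: cover_graph_def)
    have "codes_set code_nat (verts (cover_graph Cs Is)) (s_vertices (code_list code_interval Is))"
      unfolding codes_set_def s_vertices_code
      by (intro exI[of _ "0 # 1 # rev (map fst (numbered 2 Is))"])
        (auto simp: cover_graph_def set_fst_numbered distinct_fst_numbered)
    moreover have "codes_set code_tedge (tedges (cover_graph Cs Is))
        (s_edges (code_list code_interval Cs) (code_list code_interval Is))"
      unfolding codes_set_def s_edges_code
      by (intro exI[of _ "push_paths Is Cs []"])
        (auto simp: cover_graph_def intro: distinct_push_paths)
    ultimately show "inst_code temporal_separator y (s_reduce v)"
      by (auto simp: temporal_separator_def y_def v_eq s_reduce_def s_length_code code_nat_def
          cover_graph_def)
  next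
    fix k
    show "(\<exists>A\<in>sols disc_sc (\<Gamma>, \<I>). cost disc_sc A \<le> k) \<longleftrightarrow>
        (\<exists>S\<in>sols temporal_separator y. cost temporal_separator S \<le> k)"
      unfolding costs using pick ids by metis
  next
    fix S w assume S: "S \<in> sols temporal_separator y" and "sol_code temporal_separator S w"
    then obtain ns where ns: "set ns = S" "w = code_list code_nat ns"
      by (auto simp: temporal_separator_def codes_set_def)
    show "\<exists>A\<in>sols disc_sc (\<Gamma>, \<I>). sol_code disc_sc A (s_back (Cell v w)) \<and>
        (optimal temporal_separator y S \<longrightarrow> optimal disc_sc (\<Gamma>, \<I>) A)"
    proof (intro bexI[of _ "pick S"] conjI impI)
      \<comment> \<open>The list returned by \<open>s_back\<close> follows the order of
        \<open>Is\<close>, so its distinctness comes from \<open>Is\<close>, however the separator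
        is listed.\<close>
      have "distinct (map snd (filter (\<lambda>(i, I). i \<in> set ns) (numbered 2 Is)))"
        by (rule distinct_map_filter) (simp add: Is(1))
      moreover have "snd ` {x \<in> ?N. case x of (i, I) \<Rightarrow> i \<in> S} = pick S"
        by (simp add: pick_def split_beta)
      ultimately show "sol_code disc_sc (pick S) (s_back (Cell v w))"
        by (auto simp: disc_sc_def codes_set_def v_eq ns s_back_code
            intro!: exI[of _ "rev (map snd (filter (\<lambda>(i, I). i \<in> set ns) (numbered 2 Is)))"])
      assume "optimal temporal_separator y S"
      thus "optimal disc_sc (\<Gamma>, \<I>) (pick S)"
        unfolding optimal_def costs using pick ids by metis
    qed (rule pick(1)[OF S])
  qed
qed

theorem theorem9:
  shows "poly_time_reducible disc_sc temporal_separator"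
  unfolding poly_time_reducible_def
  using reduction_disc_sc poly_time_on_if_ptime[OF ptime_s_reduce[OF ptime_id]]
    poly_time_on_if_ptime[OF ptime_s_back[OF ptime_id]] by blast

end
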